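(* Let $R(q)=\dfrac{(q;q^5)_\infty(q^4;q^5)_\infty}{(q^2;q^5)_\infty(q^3;q^5)_\infty}$ and define integers $D(n)$ by $\dfrac{R(q^5)}{R^5(q)}=\sum_{n=0}^{\infty}D(n)q^{n}$. Then for all nonnegative integers $n$, $$D(5n)<0,\quad D(5n+2)>0,\quad D(5n+3)>0,\quad D(5n+4)<0,$$ with the sole exception $D(0)=1$.
   Context: For complex $a,q$ with $|q|<1$, $(a;q)_\infty:=\prod_{k=0}^{\infty}(1-aq^k)$. All series are power series in $q$. *)

theory Defs
  imports "HOL-Analysis.Analysis"
begin

definition qpoch_inf :: "complex \<Rightarrow> complex \<Rightarrow> complex" where
  "qpoch_inf a q = (\<Prod>k. 1 - a * q ^ k)"

definition RR :: "complex \<Rightarrow> complex" where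
  "RR q = (qpoch_inf q (q ^ 5) * qpoch_inf (q ^ 4) (q ^ 5)) /
          (qpoch_inf (q ^ 2) (q ^ 5) * qpoch_inf (q ^ 3) (q ^ 5))"

text \<open>
  The integer coefficient sequence of the power series of \<open>RR (q ^ 5) / RR q ^ 5\<close> on the
  open unit disc. It exists because the function is holomorphic there (no factor
  \<open>1 - q ^ m\<close> with \<open>m > 0\<close> vanishes) and the factors and their inverses
  have integer Taylor coefficients; it is unique by uniqueness of power series expansions.
\<close>

definition D :: "nat \<Rightarrow> int" where
  "D = (THE d. \<forall>q::complex. norm q < 1 \<longrightarrow>
          (\<lambda>n. of_int (d n) * q ^ n) sums (RR (q ^ 5) / RR q ^ 5))"

end

theory Submission
  imports Defs "HOL-Complex_Analysis.Complex_Analysis"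
begin

text \<open>
  Put \<open>u = q R(q)\<^sup>5\<close> and \<open>v = q R(q\<^sup>5)\<close>. Splitting the Jacobi triple product series at a primitive
  fifth root of unity \<open>\<zeta>\<close> by residues modulo 5 evaluates the theta function there as a multiple of
  \<open>1 - \<phi> v\<close>, where \<open>\<phi> = 1 + \<zeta> + 1/\<zeta>\<close>. Multiplying this evaluation over the five fifth roots of \<open>q\<close>
  gives the same theta function, to the fifth power, as a multiple of \<open>1 - \<phi>\<^sup>5 u\<close>. Comparing
  \<open>\<zeta>\<close> with \<open>\<zeta>\<^sup>2\<close> yields Ramanujan's relation
  \<open>u (1 + 3v + 4v\<^sup>2 + 2v\<^sup>3 + v\<^sup>4) = v (1 - 2v + 4v\<^sup>2 - 3v\<^sup>3 + v\<^sup>4)\<close>, so \<open>R(q\<^sup>5) / R(q)\<^sup>5 = v / u\<close>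
  is rational in \<open>v\<close>, and expanding the fraction suitably makes its denominator
  \<open>1 - 11v\<^sup>5 - v\<^sup>1\<^sup>0\<close>.

  Since \<open>v\<^sup>5\<close> is a series in \<open>q\<^sup>5\<close>, this is a 5-dissection. With \<open>R = A / B\<close>, \<open>a = 1/A\<close>, \<open>b = 1/B\<close>,
  the components for the residues 0, 2, 3, 4 are
  \<open>1 - 25 q a\<^sup>6 b\<^sup>6\<close>, \<open>10 a\<^sup>4 b\<^sup>3 (a\<^sup>5 - 3 q b\<^sup>5)\<close>, \<open>5 a\<^sup>3 b\<^sup>4 (a\<^sup>5 - 3 q b\<^sup>5)\<close> and
  \<open>-5 (3 a\<^sup>7 b\<^sup>5 + q a\<^sup>2 b\<^sup>1\<^sup>0)\<close>. The series \<open>a\<close> and \<open>b\<close> have nonnegative coefficients, and so does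
  \<open>a\<^sup>5 - 3 q b\<^sup>5\<close> after division by \<open>(1 - q) (1 - q\<^sup>2)\<close>: exchange the factors of the products
  one residue block at a time, starting from an explicit polynomial.
\<close>

section \<open>Infinite q-Pochhammer symbols\<close>

lemma convergent_prod_qpoch:
  fixes a q :: complex
  assumes "norm q < 1"
  shows "convergent_prod (\<lambda>k. 1 - a * q ^ k)"
proof -
  have "summable (\<lambda>k. norm a * norm q ^ k)"
    using assms by (intro summable_mult summable_geometric) auto
  then have "abs_convergent_prod (\<lambda>k. 1 - a * q ^ k)"
    by (intro summable_imp_abs_convergent_prod) (simp add: norm_mult norm_power)
  then show ?thesis
    by (rule abs_convergent_prod_imp_convergent_prod)
qed

lemma qpoch_inf_LIMSEQ:
  assumes "norm q < 1"
  shows "(\<lambda>n. \<Prod>k<n. 1 - a * q ^ k) \<longlonglongrightarrow> qpoch_inf a q"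
  unfolding qpoch_inf_def
  by (intro has_prod_imp_tendsto' convergent_prod_has_prod convergent_prod_qpoch assms)

lemma norm_mult_power_less_1:
  fixes a q :: "'a :: real_normed_field"
  assumes "norm a < 1" "norm q < 1"
  shows "norm (a * q ^ k) < 1"
proof -
  have "norm a * norm q ^ k \<le> norm a * 1"
    using assms by (intro mult_left_mono power_le_one) auto
  then show ?thesis
    using assms by (simp add: norm_mult norm_power)
qed

lemma one_minus_nonzero:
  fixes x :: "'a :: real_normed_field"
  assumes "norm x < 1"
  shows "1 - x \<noteq> 0"
  using assms by (metis eq_iff_diff_eq_0 norm_one less_irrefl)

lemma qpoch_inf_nonzero:
  assumes "norm a < 1" "norm q < 1"
  shows "qpoch_inf a q \<noteq> 0"
  unfolding qpoch_inf_def
  using assms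
  by (intro prodinf_nonzero convergent_prod_qpoch one_minus_nonzero norm_mult_power_less_1)

lemma qpoch_inf_step:
  assumes "norm q < 1"
  shows "qpoch_inf a q = (1 - a) * qpoch_inf (a * q) q"
proof -
  have "(\<lambda>n. \<Prod>k<Suc n. 1 - a * q ^ k) \<longlonglongrightarrow> qpoch_inf a q"
    using qpoch_inf_LIMSEQ[OF assms] by (rule LIMSEQ_Suc)
  moreover have "(\<lambda>n. \<Prod>k<Suc n. 1 - a * q ^ k) = (\<lambda>n. (1 - a) * (\<Prod>k<n. 1 - (a * q) * q ^ k))"
    by (subst prod.lessThan_Suc_shift) (simp add: mult.assoc)
  moreover have "(\<lambda>n. (1 - a) * (\<Prod>k<n. 1 - (a * q) * q ^ k)) \<longlonglongrightarrow> (1 - a) * qpoch_inf (a * q) q"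
    by (intro tendsto_intros qpoch_inf_LIMSEQ assms)
  ultimately show ?thesis
    using LIMSEQ_unique by metis
qed

lemma prod_lessThan_5_mult:
  fixes f :: "nat \<Rightarrow> 'a :: comm_monoid_mult"
  shows "(\<Prod>k<5*n. f k) =
    (\<Prod>k<n. f (5*k) * f (5*k+1) * f (5*k+2) * f (5*k+3) * f (5*k+4))"
proof (induction n)
  case (Suc n)
  have "5 * Suc n = Suc (Suc (Suc (Suc (Suc (5 * n)))))"
    by simp
  then show ?case
    by (simp only: prod.lessThan_Suc Suc) (simp add: eval_nat_numeral mult_ac)
qed simp

lemma filterlim_times_5: "filterlim (\<lambda>n::nat. 5 * n) at_top sequentially"
  by (rule filterlim_subseq) (auto simp: strict_mono_def)

lemma qpoch_inf_split_5:
  assumes "norm q < 1"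
  shows "qpoch_inf q q = qpoch_inf q (q^5) * qpoch_inf (q^2) (q^5) * qpoch_inf (q^3) (q^5) *
           qpoch_inf (q^4) (q^5) * qpoch_inf (q^5) (q^5)"
proof -
  have q5: "norm (q^5) < 1"
    using assms by (simp add: norm_power power_Suc_less_one power_less_one_iff)
  have "(\<lambda>n. \<Prod>k<5*n. 1 - q * q ^ k) \<longlonglongrightarrow> qpoch_inf q q"
    using filterlim_compose[OF qpoch_inf_LIMSEQ[OF assms] filterlim_times_5] .
  moreover have "(\<Prod>k<5*n. 1 - q * q ^ k) = (\<Prod>k<n. 1 - q * (q^5)^k) * (\<Prod>k<n. 1 - q^2 * (q^5)^k) *
       (\<Prod>k<n. 1 - q^3 * (q^5)^k) * (\<Prod>k<n. 1 - q^4 * (q^5)^k) * (\<Prod>k<n. 1 - q^5 * (q^5)^k)" for n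
  proof -
    have e: "q * q ^ (5 * k + j) = q ^ Suc j * (q ^ 5) ^ k" for k j
      by (simp add: power_add power_mult)
    have e0: "q * q ^ (5 * k) = q * (q ^ 5) ^ k" for k
      using e[of k 0] by simp
    show ?thesis
      unfolding prod_lessThan_5_mult prod.distrib[symmetric] e e0 by (simp add: eval_nat_numeral)
  qed
  moreover have "(\<lambda>n. (\<Prod>k<n. 1 - q * (q^5)^k) * (\<Prod>k<n. 1 - q^2 * (q^5)^k) *
       (\<Prod>k<n. 1 - q^3 * (q^5)^k) * (\<Prod>k<n. 1 - q^4 * (q^5)^k) * (\<Prod>k<n. 1 - q^5 * (q^5)^k))
     \<longlonglongrightarrow> qpoch_inf q (q^5) * qpoch_inf (q^2) (q^5) * qpoch_inf (q^3) (q^5) *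
           qpoch_inf (q^4) (q^5) * qpoch_inf (q^5) (q^5)"
    by (intro tendsto_intros qpoch_inf_LIMSEQ q5)
  ultimately show ?thesis
    using LIMSEQ_unique by (metis (no_types, lifting) ext)
qed

section \<open>Gaussian binomial coefficients and the finite q-binomial theorem\<close>

definition qfact :: "complex \<Rightarrow> nat \<Rightarrow> complex" where
  "qfact q n = (\<Prod>k<n. 1 - q * q ^ k)"

text \<open>The value 0 for \<open>k > n\<close> makes Pascal's rule hold at \<open>k = n\<close> as
  well.\<close>

definition qbinom :: "complex \<Rightarrow> nat \<Rightarrow> nat \<Rightarrow> complex" where
  "qbinom q n k = (if k \<le> n then qfact q n / (qfact q k * qfact q (n - k)) else 0)"

lemma qfact_nonzero:
  assumes "norm q < 1"
  shows "qfact q n \<noteq> 0"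
  unfolding qfact_def
  using one_minus_nonzero[OF norm_mult_power_less_1[OF assms assms]] by (simp add: prod_zero_iff)

lemma qfact_Suc: "qfact q (Suc n) = qfact q n * (1 - q ^ Suc n)"
  by (simp add: qfact_def)

lemma qbinom_Suc:
  assumes "norm q < 1" "k \<le> n"
  shows "qbinom q (Suc n) (Suc k) = qbinom q n (Suc k) + q ^ (n - k) * qbinom q n k"
proof (cases "k = n")
  case True
  then show ?thesis
    using qfact_nonzero[OF assms(1), of n] qfact_nonzero[OF assms(1), of "Suc n"]
    by (simp add: qbinom_def qfact_def[of q 0])
next
  case False
  with assms obtain d where d: "n = Suc k + d"
    by (metis less_eq_Suc_le le_Suc_ex nat_less_le)
  have nz: "1 - q ^ Suc j \<noteq> 0" for j
    using one_minus_nonzero[OF norm_mult_power_less_1[OF assms(1) assms(1)], of j] by simp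
  have e: "q ^ Suc n = q ^ Suc k * q ^ Suc d"
    by (simp add: d power_add)
  have n: "Suc n - Suc k = Suc d" "n - Suc k = d" "n - k = Suc d"
    using d by auto
  \<comment> \<open>The q-Pascal rule for \<open>u = q^(k+1)\<close> and \<open>w = q^(d+1)\<close>,
    so that \<open>u * w = q^(n+1)\<close>: it reduces to
    \<open>1 - u * w = (1 - w) + w * (1 - u)\<close>.\<close>
  have field: "X * (1 - u * w) / (F * (1 - u) * (G * (1 - w))) =
      X / (F * (1 - u) * G) + w * (X / (F * (G * (1 - w))))"
    if "1 - u \<noteq> 0" "1 - w \<noteq> 0" "F \<noteq> 0" "G \<noteq> 0" for X u w F G :: complex
    using that by (simp add: divide_simps) (simp add: algebra_simps)
  show ?thesis
    unfolding qbinom_def n qfact_Suc e using d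
    by (simp add: field[OF nz[of k] nz[of d] qfact_nonzero[OF assms(1)] qfact_nonzero[OF assms(1)]]
        del: power_Suc)
qed

text \<open>Induction on \<open>n\<close>: the new factor \<open>1 + y * q^n\<close> combines
  neighbouring terms exactly as Pascal's rule does.\<close>

theorem qbinomial:
  assumes "norm q < 1"
  shows "(\<Prod>k<n. 1 + y * q ^ k) = (\<Sum>j\<le>n. q ^ (j * (j - 1) div 2) * qbinom q n j * y ^ j)"
proof (induction n)
  case 0
  then show ?case by (simp add: qbinom_def qfact_def)
next
  case (Suc n)
  let ?t = "\<lambda>n j. q ^ (j * (j - 1) div 2) * qbinom q n j * y ^ j"
  have e: "Suc j * (Suc j - 1) div 2 = j * (j - 1) div 2 + j" for j :: nat
    by (cases j) (auto simp: algebra_simps)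
  have b0: "qbinom q m 0 = 1" for m
    using qfact_nonzero[OF assms] by (simp add: qbinom_def qfact_def)
  have "(\<Sum>j\<le>Suc n. ?t (Suc n) j) = 1 + (\<Sum>j\<le>n. ?t (Suc n) (Suc j))"
    by (subst sum.atMost_Suc_shift) (simp add: b0)
  also have "(\<Sum>j\<le>n. ?t (Suc n) (Suc j)) = (\<Sum>j\<le>n. ?t n (Suc j) + y * q ^ n * ?t n j)"
  proof (intro sum.cong refl)
    fix j assume "j \<in> {..n}"
    then have j: "j \<le> n" by simp
    then have "q ^ j * q ^ (n - j) = q ^ n"
      by (metis le_add_diff_inverse power_add)
    then show "?t (Suc n) (Suc j) = ?t n (Suc j) + y * q ^ n * ?t n j"
      unfolding qbinom_Suc[OF assms j] e power_add by (simp add: algebra_simps)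
  qed
  also have "\<dots> = (\<Sum>j\<le>n. ?t n (Suc j)) + y * q ^ n * (\<Sum>j\<le>n. ?t n j)"
    by (simp add: sum.distrib sum_distrib_left)
  also have "1 + ((\<Sum>j\<le>n. ?t n (Suc j)) + y * q ^ n * (\<Sum>j\<le>n. ?t n j)) =
      (\<Sum>j\<le>Suc n. ?t n j) + y * q ^ n * (\<Sum>j\<le>n. ?t n j)"
    by (simp add: sum.atMost_Suc_shift b0 del: sum.atMost_Suc)
  also have "(\<Sum>j\<le>Suc n. ?t n j) = (\<Sum>j\<le>n. ?t n j)"
    by (simp add: qbinom_def)
  finally show ?case
    using Suc by (simp add: algebra_simps)
qed

section \<open>The Jacobi triple product\<close>

text \<open>General term of the bilateral theta series; \<open>n * (n - 1)\<close> is even, so the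
  division in the exponent is exact.\<close>

definition jtp_term :: "complex \<Rightarrow> complex \<Rightarrow> int \<Rightarrow> complex" where
  "jtp_term x q n = (-x) powi n * q powi (n * (n - 1) div 2)"

lemma jtp_term_Suc:
  assumes "x \<noteq> 0" "q \<noteq> 0"
  shows "jtp_term x q (int (Suc k)) = jtp_term x q (int k) * (- x * q ^ k)"
proof -
  have e: "(int (Suc k) * (int (Suc k) - 1)) div 2 = int k * (int k - 1) div 2 + int k"
    by (simp add: algebra_simps)
  have "q powi (int (Suc k) * (int (Suc k) - 1) div 2) = q powi (int k * (int k - 1) div 2) * q ^ k"
    unfolding e using assms by (subst power_int_add) auto
  moreover have "(-x) powi (int (Suc k)) = (-x) powi (int k) * (-x)"
    by (simp only: power_int_of_nat power_Suc mult.commute)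
  ultimately show ?thesis
    unfolding jtp_term_def by (simp only: mult_ac)
qed

text \<open>Reflection exchanges \<open>x\<close> and \<open>q / x\<close>, so the negative half of
  the theta series converges for the same reason as the positive half.\<close>

lemma jtp_term_uminus:
  assumes "x \<noteq> 0" "q \<noteq> 0"
  shows "jtp_term x q (- n) = jtp_term (q / x) q n"
proof -
  have "even (n * (n - 1))" by simp
  then have e: "(- n) * (- n - 1) div 2 = n * (n - 1) div 2 + n"
    by (auto simp: algebra_simps elim!: evenE)
  have "(-x) powi (- n) * q powi n = (- (q / x)) powi n"
  proof -
    have "q powi n = (- (q / x) * (- x)) powi n"
      using assms by simp
    also have "\<dots> = (- (q / x)) powi n * (- x) powi n"
      by (rule power_int_mult_distrib)
    finally show ?thesis
      using assms by (simp add: power_int_minus divide_simps)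
  qed
  then show ?thesis
    unfolding jtp_term_def e using assms by (simp add: power_int_add mult_ac)
qed

lemma summable_norm_jtp_term:
  assumes "x \<noteq> 0" "q \<noteq> 0" "norm q < 1"
  shows "summable (\<lambda>k. norm (jtp_term x q (int k)))"
proof -
  have "(\<lambda>k. norm x * norm q ^ k) \<longlonglongrightarrow> norm x * 0"
    using assms by (intro tendsto_intros LIMSEQ_power_zero) auto
  then have "eventually (\<lambda>k. norm x * norm q ^ k < 1 / 2) sequentially"
    by (rule order_tendstoD) simp
  then obtain N where N: "norm x * norm q ^ k < 1 / 2" if "k \<ge> N" for k
    by (auto simp: eventually_at_top_linorder)
  show ?thesis
  proof (rule summable_ratio_test)
    fix k assume "N \<le> k"
    have "norm (norm (jtp_term x q (int (Suc k)))) =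
        (norm x * norm q ^ k) * norm (jtp_term x q (int k))"
      unfolding jtp_term_Suc[OF assms(1,2)] by (simp add: norm_mult norm_power)
    also have "\<dots> \<le> 1 / 2 * norm (jtp_term x q (int k))"
      using N[OF \<open>N \<le> k\<close>] by (intro mult_right_mono) auto
    finally show "norm (norm (jtp_term x q (int (Suc k)))) \<le> 1 / 2 * norm (norm (jtp_term x q (int k)))"
      by simp
  qed simp
qed

lemma sum_symmetric_int:
  fixes h :: "int \<Rightarrow> 'a :: comm_monoid_add"
  shows "(\<Sum>n = - int m..int m. h n) = (\<Sum>k\<le>m. if k = 0 then h 0 else h (int k) + h (- int k))"
proof (induction m)
  case (Suc m)
  have "{- int (Suc m)..int (Suc m)} = insert (int (Suc m)) (insert (- int (Suc m)) {- int m..int m})"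
    by auto
  then show ?case
    using Suc by (simp add: add_ac)
qed simp

lemma prod_lessThan_add:
  fixes f :: "nat \<Rightarrow> 'a :: comm_monoid_mult"
  shows "(\<Prod>k<m + n. f k) = (\<Prod>k<m. f k) * (\<Prod>k<n. f (k + m))"
  by (induction n) (simp_all add: mult_ac add_ac)

text \<open>The q-binomial theorem with \<open>2 * m\<close> factors, centred by
  \<open>y = - x / q^m\<close>: the upper \<open>m\<close> factors are \<open>1 - x * q^k\<close>,
  and the lower \<open>m\<close>, read backwards, are multiples of
  \<open>1 - q / x * q^k\<close>.\<close>

lemma finite_jacobi_triple_product:
  assumes "x \<noteq> 0" "q \<noteq> 0" "norm q < 1"
  shows "(\<Prod>k<m. 1 - x * q ^ k) * (\<Prod>k<m. 1 - q / x * q ^ k) =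
    (\<Sum>n = - int m..int m. jtp_term x q n * qbinom q (2 * m) (nat (int m + n)))"
proof -
  define y where "y = - x / q ^ m"
  \<comment> \<open>\<open>c\<close> collects the multiples \<open>- x / q^(k+1)\<close> pulled out
    of the lower factors; it cancels at the end.\<close>
  define c where "c = (-x) powi int m * q powi (- (int m * (int m + 1) div 2))"
  have c_eq: "(\<Prod>k<m. - x / q ^ Suc k) = c"
    unfolding c_def
  proof (induction m)
    case (Suc m)
    have e: "- (int (Suc m) * (int (Suc m) + 1) div 2) = - (int m * (int m + 1) div 2) + (- int (Suc m))"
      by (simp add: algebra_simps)
    have "q powi (- (int (Suc m) * (int (Suc m) + 1) div 2)) =
        q powi (- (int m * (int m + 1) div 2)) * q powi (- int (Suc m))"
      unfolding e using assms by (subst power_int_add) auto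
    also have "q powi (- int (Suc m)) = 1 / q ^ Suc m"
      by (simp only: power_int_minus power_int_of_nat) (simp add: divide_inverse)
    finally have e': "q powi (- (int (Suc m) * (int (Suc m) + 1) div 2)) =
        q powi (- (int m * (int m + 1) div 2)) * (1 / q ^ Suc m)" .
    show ?case
      unfolding prod.lessThan_Suc Suc e' power_int_of_nat by simp
  qed simp
  have c_nz: "c \<noteq> 0"
    using assms by (simp add: c_def)
  have "(\<Prod>k<2*m. 1 + y * q ^ k) = (\<Prod>k<m. 1 + y * q ^ k) * (\<Prod>k<m. 1 + y * q ^ (k + m))"
    unfolding mult_2 by (rule prod_lessThan_add)
  also have "(\<Prod>k<m. 1 + y * q ^ (k + m)) = (\<Prod>k<m. 1 - x * q ^ k)"
    using assms by (intro prod.cong refl) (simp add: y_def power_add)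
  also have "(\<Prod>k<m. 1 + y * q ^ k) = (\<Prod>k<m. 1 + y * q ^ (m - Suc k))"
    by (rule prod.nat_diff_reindex[symmetric])
  also have "\<dots> = (\<Prod>k<m. (- x / q ^ Suc k) * (1 - q / x * q ^ k))"
  proof (intro prod.cong refl)
    fix k assume "k \<in> {..<m}"
    then have "q ^ m = q ^ (m - Suc k) * q ^ Suc k"
      by (simp only: power_add[symmetric]) simp
    then have "y * q ^ (m - Suc k) = - x / q ^ Suc k"
      using assms by (simp add: y_def divide_simps)
    then have "1 + y * q ^ (m - Suc k) = 1 + - x / q ^ Suc k"
      by simp
    also have "\<dots> = (- x / q ^ Suc k) * (1 - q / x * q ^ k)"
      using assms by (simp add: field_simps)
    finally show "1 + y * q ^ (m - Suc k) = (- x / q ^ Suc k) * (1 - q / x * q ^ k)" .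
  qed
  also have "\<dots> = c * (\<Prod>k<m. 1 - q / x * q ^ k)"
    by (simp only: prod.distrib c_eq)
  finally have "c * ((\<Prod>k<m. 1 - x * q ^ k) * (\<Prod>k<m. 1 - q / x * q ^ k)) = (\<Prod>k<2*m. 1 + y * q ^ k)"
    by (simp add: mult_ac)
  also have "\<dots> = (\<Sum>j\<le>2*m. q ^ (j * (j - 1) div 2) * qbinom q (2 * m) j * y ^ j)"
    by (rule qbinomial) fact
  also have "\<dots> = (\<Sum>n = - int m..int m. c * (jtp_term x q n * qbinom q (2 * m) (nat (int m + n))))"
  proof (rule sum.reindex_bij_witness[of _ "\<lambda>n. nat (int m + n)" "\<lambda>j. int j - int m"])
    fix j assume "j \<in> {..2*m}"
    have j1: "int (j * (j - 1) div 2) = int j * (int j - 1) div 2"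
      by (cases j) (auto simp: zdiv_int algebra_simps)
    have half: "2 * (a * (a - 1) div 2) = a * (a - 1)" for a :: int
      by (intro dvd_mult_div_cancel) auto
    have half': "2 * (a * (a + 1) div 2) = a * (a + 1)" for a :: int
      by (intro dvd_mult_div_cancel) auto
    have "(int j - int m) * (int j - int m - 1) =
        int j * (int j - 1) - 2 * (int m * int j) + int m * (int m + 1)"
      by (simp add: algebra_simps)
    \<comment> \<open>Under the shift \<open>j = m + n\<close> the exponent splits into that of
      \<open>c\<close> and that of the theta term.\<close>
    then have e: "int j * (int j - 1) div 2 + (- int m * int j) =
        - (int m * (int m + 1) div 2) + (int j - int m) * (int j - int m - 1) div 2"
      using half[of "int j"] half[of "int j - int m"] half'[of "int m"] by linarith
    have "q ^ (j * (j - 1) div 2) * y ^ j =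
        q powi (int j * (int j - 1) div 2) * ((-x) powi int j * q powi (- int m * int j))"
    proof -
      have "q ^ (j * (j - 1) div 2) = q powi (int j * (int j - 1) div 2)"
        by (simp only: j1[symmetric] power_int_of_nat)
      moreover have "y ^ j = (-x) powi int j * q powi (- int m * int j)"
      proof -
        have "y ^ j = (- x * inverse (q ^ m)) ^ j"
          by (simp add: y_def divide_inverse)
        also have "\<dots> = (- x) ^ j * inverse (q ^ (m * j))"
          by (simp only: power_mult_distrib power_inverse power_mult)
        also have "inverse (q ^ (m * j)) = q powi (- int (m * j))"
          by (simp only: power_int_minus power_int_of_nat)
        finally show ?thesis by simp
      qed
      ultimately show ?thesis by simp
    qed
    also have "\<dots> = (-x) powi int j * q powi (int j * (int j - 1) div 2 + (- int m * int j))"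
      using assms by (subst power_int_add) auto
    also have "\<dots> = (-x) powi (int m + (int j - int m)) *
        q powi (- (int m * (int m + 1) div 2) + (int j - int m) * (int j - int m - 1) div 2)"
      unfolding e by simp
    also have "\<dots> = c * jtp_term x q (int j - int m)"
    proof -
      have "- x \<noteq> 0" using assms by simp
      then show ?thesis
        unfolding c_def jtp_term_def by (subst power_int_add, use assms in simp)+ (simp only: mult_ac)
    qed
    finally show "c * (jtp_term x q (int j - int m) * qbinom q (2 * m) (nat (int m + (int j - int m)))) =
        q ^ (j * (j - 1) div 2) * qbinom q (2 * m) j * y ^ j"
      by (simp add: mult_ac)
  qed auto
  also have "\<dots> = c * (\<Sum>n = - int m..int m. jtp_term x q n * qbinom q (2 * m) (nat (int m + n)))"
    by (simp add: sum_distrib_left)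
  finally show ?thesis
    using c_nz by simp
qed

text \<open>Let \<open>m\<close> tend to infinity in the finite identity. The q-binomials are
  bounded and tend to \<open>1 / E\<close>, and the theta terms are absolutely summable, so
  Tannery's theorem moves the limit inside the sum.\<close>

theorem jacobi_triple_product:
  assumes "x \<noteq> 0" "q \<noteq> 0" "norm q < 1"
  shows "(\<lambda>m. \<Sum>n = - int m..int m. jtp_term x q n)
    \<longlonglongrightarrow> qpoch_inf x q * qpoch_inf (q / x) q * qpoch_inf q q"
proof -
  define E where "E = qpoch_inf q q"
  \<comment> \<open>Pairing \<open>k\<close> with \<open>-k\<close> turns the bilateral sum into one
    over the naturals, with index 0 counted once. The pair shares the q-binomial
    \<open>c k m\<close>, which is set to 0 for \<open>k > m\<close> so that the sum can be
    infinite.\<close>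
  define g where "g = (\<lambda>k::nat. if k = 0 then jtp_term x q 0 else jtp_term x q (int k) + jtp_term x q (- int k))"
  define c where "c = (\<lambda>k m. if k \<le> m then qfact q (2 * m) * inverse (qfact q (m + k)) * inverse (qfact q (m - k)) else 0)"
  have E: "E \<noteq> 0"
    unfolding E_def by (intro qpoch_inf_nonzero assms)
  have lim: "qfact q \<longlonglongrightarrow> E"
    unfolding E_def qfact_def using qpoch_inf_LIMSEQ[OF assms(3), of q] by simp
  then have lim': "(\<lambda>n. inverse (qfact q n)) \<longlonglongrightarrow> inverse E"
    by (intro tendsto_inverse E)
  obtain U where U: "norm (qfact q n) \<le> U" for n
    using lim by (meson BseqE convergentI convergent_imp_Bseq)
  obtain L where L: "norm (inverse (qfact q n)) \<le> L" for n
    using lim' by (meson BseqE convergentI convergent_imp_Bseq)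
  have UL: "0 \<le> U" "0 \<le> L"
    using U L norm_ge_zero order_trans by blast+
  have c_le: "norm (c k m) \<le> U * L * L" for k m
    using U L UL unfolding c_def by (auto simp: norm_mult simp del: norm_inverse intro!: mult_mono)
  have c_lim: "c k \<longlonglongrightarrow> inverse E" for k
  proof -
    have "(\<lambda>m. qfact q (2 * m) * inverse (qfact q (m + k)) * inverse (qfact q (m - k)))
        \<longlonglongrightarrow> E * inverse E * inverse E"
      by (intro tendsto_mult filterlim_compose[OF lim] filterlim_compose[OF lim']
          filterlim_subseq filterlim_add_const_nat_at_top filterlim_minus_const_nat_at_top)
         (auto simp: strict_mono_def)
    moreover have "eventually (\<lambda>m. c k m = qfact q (2 * m) * inverse (qfact q (m + k)) * inverse (qfact q (m - k))) sequentially"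
      using eventually_ge_at_top[of k] by eventually_elim (simp add: c_def)
    ultimately show ?thesis
      using E by (simp add: tendsto_cong)
  qed
  have "summable (\<lambda>k. norm (jtp_term x q (int k)) + norm (jtp_term (q / x) q (int k)))"
    using assms by (intro summable_add summable_norm_jtp_term) auto
  then have g_sum: "summable (\<lambda>k. norm (g k))"
    by (rule summable_comparison_test')
       (auto simp: g_def jtp_term_uminus[OF assms(1,2)] norm_triangle_ineq)
  have partial: "(\<Prod>k<m. 1 - x * q ^ k) * (\<Prod>k<m. 1 - q / x * q ^ k) = (\<Sum>k. g k * c k m)" for m
  proof -
    have "(\<Prod>k<m. 1 - x * q ^ k) * (\<Prod>k<m. 1 - q / x * q ^ k) = (\<Sum>k\<le>m. g k * c k m)"
      unfolding finite_jacobi_triple_product[OF assms] sum_symmetric_int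
    proof (intro sum.cong refl)
      fix k assume k: "k \<in> {..m}"
      have b1: "qbinom q (2 * m) (nat (int m + int k)) = c k m"
        using k by (simp add: qbinom_def c_def field_simps nat_int_add mult_2)
      have b2: "qbinom q (2 * m) (nat (int m + - int k)) = c k m"
      proof -
        have "nat (int m + - int k) = m - k" "2 * m - (m - k) = m + k"
          using k by auto
        then show ?thesis
          using k by (simp add: qbinom_def c_def field_simps)
      qed
      show "(if k = 0 then jtp_term x q 0 * qbinom q (2 * m) (nat (int m + 0))
          else jtp_term x q (int k) * qbinom q (2 * m) (nat (int m + int k)) +
            jtp_term x q (- int k) * qbinom q (2 * m) (nat (int m + - int k))) = g k * c k m"
        using b1 b2 by (auto simp: g_def algebra_simps)
    qed
    also have "\<dots> = (\<Sum>k. g k * c k m)"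
      by (rule suminf_finite[symmetric]) (auto simp: c_def)
    finally show ?thesis .
  qed
  have "(\<lambda>m. \<Sum>k. g k * c k m) \<longlonglongrightarrow> (\<Sum>k. g k * inverse E)"
  proof -
    have "eventually (\<lambda>n. summable (\<lambda>k. norm (g k * c k n))) sequentially \<and>
       summable (\<lambda>k. norm (g k * inverse E)) \<and>
       (\<lambda>m. \<Sum>k. g k * c k m) \<longlonglongrightarrow> (\<Sum>k. g k * inverse E)"
    proof (rule tannerys_theorem)
      show "eventually (\<lambda>(k, m). norm (g k * c k m) \<le> norm (g k) * (U * L * L)) (at_top \<times>\<^sub>F sequentially)"
        using c_le by (intro always_eventually) (auto simp: norm_mult intro!: mult_left_mono)
      show "summable (\<lambda>k. norm (g k) * (U * L * L))"
        using g_sum by (rule summable_mult2)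
    qed (auto intro!: tendsto_intros c_lim)
    then show ?thesis by blast
  qed
  moreover have "(\<lambda>m. \<Sum>k. g k * c k m) \<longlonglongrightarrow> qpoch_inf x q * qpoch_inf (q / x) q"
    unfolding partial[symmetric] by (intro tendsto_intros qpoch_inf_LIMSEQ assms)
  ultimately have "(\<Sum>k. g k * inverse E) = qpoch_inf x q * qpoch_inf (q / x) q"
    using LIMSEQ_unique by blast
  moreover have "(\<Sum>k. g k * inverse E) = (\<Sum>k. g k) * inverse E"
    using g_sum by (intro suminf_mult2[symmetric]) (rule summable_norm_cancel)
  ultimately have "(\<Sum>k. g k) = qpoch_inf x q * qpoch_inf (q / x) q * E"
    using E by (simp add: field_simps)
  moreover have "(\<lambda>m. \<Sum>k\<le>m. g k) \<longlonglongrightarrow> (\<Sum>k. g k)"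
    by (rule summable_LIMSEQ'[OF summable_norm_cancel[OF g_sum]])
  ultimately show ?thesis
    unfolding sum_symmetric_int g_def E_def by simp
qed

section \<open>Theta functions at fifth roots of unity\<close>

definition RR_num :: "complex \<Rightarrow> complex" where
  "RR_num q = qpoch_inf q (q ^ 5) * qpoch_inf (q ^ 4) (q ^ 5)"

definition RR_den :: "complex \<Rightarrow> complex" where
  "RR_den q = qpoch_inf (q ^ 2) (q ^ 5) * qpoch_inf (q ^ 3) (q ^ 5)"

definition euler_prod :: "complex \<Rightarrow> complex" where
  "euler_prod q = qpoch_inf q q"

lemma RR_altdef: "RR q = RR_num q / RR_den q"
  by (simp add: RR_def RR_num_def RR_den_def)

lemma norm_power_less_1:
  fixes q :: "'a :: real_normed_field"
  assumes "norm q < 1" "n > 0"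
  shows "norm (q ^ n) < 1"
  using assms by (simp add: norm_power power_less_one_iff)

lemma RR_num_nonzero: "norm q < 1 \<Longrightarrow> RR_num q \<noteq> 0"
  and RR_den_nonzero: "norm q < 1 \<Longrightarrow> RR_den q \<noteq> 0"
  and euler_prod_nonzero: "norm q < 1 \<Longrightarrow> euler_prod q \<noteq> 0"
  by (simp_all add: RR_num_def RR_den_def euler_prod_def qpoch_inf_nonzero norm_power_less_1)

lemma euler_prod_eq:
  assumes "norm q < 1"
  shows "euler_prod q = RR_num q * RR_den q * euler_prod (q ^ 5)"
  using qpoch_inf_split_5[OF assms] by (simp add: RR_num_def RR_den_def euler_prod_def)

text \<open>The radius \<open>5 * M + 2\<close> makes the window a union of complete blocks of five
  around the multiples of 5, so every residue class contributes a symmetric partial sum, as the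
  triple product requires.\<close>

lemma sum_symmetric_int_mod_5:
  fixes h :: "int \<Rightarrow> 'a :: comm_monoid_add"
  shows "(\<Sum>n = - int (5 * M + 2)..int (5 * M + 2). h n) =
    (\<Sum>m = - int M..int M. h (5 * m - 2) + h (5 * m - 1) + h (5 * m) + h (5 * m + 1) + h (5 * m + 2))"
proof (induction M)
  case 0
  have "{-2..2::int} = {-2,-1,0,1,2}" by auto
  then show ?case by (simp add: add_ac)
next
  case (Suc M)
  define a where "a = int (5 * M + 2)"
  have 1: "{- int (5 * Suc M + 2)..int (5 * Suc M + 2)} =
      {- a..a} \<union> {a+1,a+2,a+3,a+4,a+5,-a-1,-a-2,-a-3,-a-4,-a-5}"
    unfolding a_def by auto
  have 2: "{- int (Suc M)..int (Suc M)} = insert (int (Suc M)) (insert (- int (Suc M)) {- int M..int M})"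
    by auto
  have a: "a \<ge> 0" by (simp add: a_def)
  have a': "5 * int (Suc M) = a + 3"
    by (simp add: a_def)
  then have a'': "5 * - int (Suc M) = - a - 3"
    by simp
  define g where "g = (\<lambda>m. h (5 * m - 2) + h (5 * m - 1) + h (5 * m) + h (5 * m + 1) + h (5 * m + 2))"
  have "(\<Sum>n = - int (5 * Suc M + 2)..int (5 * Suc M + 2). h n) =
     (\<Sum>n = - a..a. h n) + (h (a+1) + h (a+2) + h (a+3) + h (a+4) + h (a+5) +
        (h (-a-1) + h (-a-2) + h (-a-3) + h (-a-4) + h (-a-5)))"
    unfolding 1 using a by (subst sum.union_disjoint) (auto simp: add_ac)
  also have "h (a+1) + h (a+2) + h (a+3) + h (a+4) + h (a+5) = g (int (Suc M))"
    unfolding g_def a' by (simp add: add_ac)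
  also have "h (-a-1) + h (-a-2) + h (-a-3) + h (-a-4) + h (-a-5) = g (- int (Suc M))"
  proof -
    have "- a - 3 - 2 = - a - 5" "- a - 3 - 1 = - a - 4" "- a - 3 + 1 = - a - 2" "- a - 3 + 2 = - a - 1"
      by simp_all
    then show ?thesis
      unfolding g_def a'' by (simp only: add_ac)
  qed
  also have "(\<Sum>n = - a..a. h n) = (\<Sum>m = - int M..int M. g m)"
    using Suc unfolding a_def g_def .
  also have "\<dots> + (g (int (Suc M)) + g (- int (Suc M))) = (\<Sum>m = - int (Suc M)..int (Suc M). g m)"
    unfolding 2 by (simp add: add_ac)
  finally show ?case
    unfolding g_def .
qed

text \<open>Since \<open>(- \<zeta>)^5 = -1\<close>, the root of unity survives only in the factor
  of index \<open>r\<close>; expanding the quadratic exponent leaves a theta term with base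
  \<open>q^25\<close>.\<close>

lemma jtp_term_mod_5:
  assumes "\<zeta> ^ 5 = 1" "q \<noteq> 0"
  shows "jtp_term \<zeta> q (5 * m + r) = jtp_term \<zeta> q r * jtp_term (q powi (5 * r + 10)) (q ^ 25) m"
proof -
  have z: "\<zeta> \<noteq> 0" using assms by auto
  have half: "2 * (a * (a - 1) div 2) = a * (a - 1)" for a :: int
    by (intro dvd_mult_div_cancel) auto
  have "(5 * m + r) * (5 * m + r - 1) = r * (r - 1) + 2 * ((5 * r + 10) * m) + 25 * (m * (m - 1))"
    by (simp add: algebra_simps)
  then have e: "(5 * m + r) * (5 * m + r - 1) div 2 =
      r * (r - 1) div 2 + ((5 * r + 10) * m + 25 * (m * (m - 1) div 2))"
    using half[of m] half[of r] half[of "5 * m + r"] by linarith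
  have "q powi ((5 * m + r) * (5 * m + r - 1) div 2) =
     q powi (r * (r - 1) div 2) * (q powi ((5 * r + 10) * m) * q powi (25 * (m * (m - 1) div 2)))"
    unfolding e using assms by (subst power_int_add, simp)+ simp
  also have "q powi ((5 * r + 10) * m) = (q powi (5 * r + 10)) powi m"
    by (simp add: power_int_mult)
  also have "q powi (25 * (m * (m - 1) div 2)) = (q ^ 25) powi (m * (m - 1) div 2)"
    by (simp add: power_int_mult)
  finally have 1: "q powi ((5 * m + r) * (5 * m + r - 1) div 2) = q powi (r * (r - 1) div 2) *
     ((q powi (5 * r + 10)) powi m * (q ^ 25) powi (m * (m - 1) div 2))" .
  have "(- \<zeta>) powi (5 * m + r) = (- \<zeta>) powi r * ((- \<zeta>) ^ 5) powi m"
    using z by (simp add: power_int_add power_int_mult)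
  also have "(- \<zeta>) ^ 5 = -1"
    using assms by simp
  finally have 2: "(- \<zeta>) powi (5 * m + r) = (- \<zeta>) powi r * (-1) powi m" .
  have "(- (q powi (5 * r + 10))) powi m = (-1) powi m * (q powi (5 * r + 10)) powi m"
    by (metis mult_minus1 power_int_mult_distrib)
  then show ?thesis
    unfolding jtp_term_def 1 2 by (simp only: mult_ac)
qed

lemma qpoch_inf_1: "norm q < 1 \<Longrightarrow> qpoch_inf 1 q = 0"
  by (subst qpoch_inf_step) auto

text \<open>Split the triple product series at a fifth root of unity by residues modulo 5: one of the
  five theta series vanishes and the other four agree in pairs.\<close>

lemma theta_root_of_unity:
  assumes "\<zeta> ^ 5 = 1" "\<zeta> \<noteq> 1" "q \<noteq> 0" "norm q < 1"
  shows "qpoch_inf (\<zeta> * q) q * qpoch_inf (inverse \<zeta> * q) q * euler_prod q =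
    RR_den (q ^ 5) * euler_prod (q ^ 25) * (1 - (1 + \<zeta> + inverse \<zeta>) * (q * RR (q ^ 5)))"
proof -
  have z: "\<zeta> \<noteq> 0" using assms by auto
  have q: "norm (q ^ n) < 1" if "n > 0" for n
    using assms that by (intro norm_power_less_1)
  define Q where "Q = q ^ 25"
  have Q: "Q \<noteq> 0" "norm Q < 1"
    unfolding Q_def using assms q[of 25] by auto
  define T where "T = (\<lambda>x M. \<Sum>m = - int M..int M. jtp_term x Q m)"
  define \<theta> where "\<theta> = (\<lambda>x. qpoch_inf x Q * qpoch_inf (Q / x) Q * qpoch_inf Q Q)"
  have T: "T x \<longlonglongrightarrow> \<theta> x" if "x \<noteq> 0" for x
    unfolding T_def \<theta>_def using that Q by (intro jacobi_triple_product)
  have "(\<lambda>M. \<Sum>n = - int (5 * M + 2)..int (5 * M + 2). jtp_term \<zeta> q n)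
      \<longlonglongrightarrow> qpoch_inf \<zeta> q * qpoch_inf (q / \<zeta>) q * qpoch_inf q q"
    by (rule filterlim_compose[OF jacobi_triple_product])
       (use z assms in \<open>auto intro!: filterlim_subseq simp: strict_mono_def simp del: of_nat_add of_nat_mult\<close>)
  moreover have "(\<Sum>n = - int (5 * M + 2)..int (5 * M + 2). jtp_term \<zeta> q n) =
     jtp_term \<zeta> q (-2) * T 1 M + jtp_term \<zeta> q (-1) * T (q ^ 5) M + jtp_term \<zeta> q 0 * T (q ^ 10) M +
     jtp_term \<zeta> q 1 * T (q ^ 15) M + jtp_term \<zeta> q 2 * T (q ^ 20) M" for M
    unfolding sum_symmetric_int_mod_5 T_def sum_distrib_left sum.distrib[symmetric] Q_def
    using jtp_term_mod_5[OF assms(1,3), of _ "-2"] jtp_term_mod_5[OF assms(1,3), of _ "-1"]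
      jtp_term_mod_5[OF assms(1,3), of _ 0] jtp_term_mod_5[OF assms(1,3), of _ 1]
      jtp_term_mod_5[OF assms(1,3), of _ 2]
    by (intro sum.cong refl) simp
  moreover have "(\<lambda>M. jtp_term \<zeta> q (-2) * T 1 M + jtp_term \<zeta> q (-1) * T (q ^ 5) M +
     jtp_term \<zeta> q 0 * T (q ^ 10) M + jtp_term \<zeta> q 1 * T (q ^ 15) M + jtp_term \<zeta> q 2 * T (q ^ 20) M)
    \<longlonglongrightarrow> jtp_term \<zeta> q (-2) * \<theta> 1 + jtp_term \<zeta> q (-1) * \<theta> (q ^ 5) +
     jtp_term \<zeta> q 0 * \<theta> (q ^ 10) + jtp_term \<zeta> q 1 * \<theta> (q ^ 15) + jtp_term \<zeta> q 2 * \<theta> (q ^ 20)"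
    using assms by (intro tendsto_intros T) auto
  ultimately have *: "qpoch_inf \<zeta> q * qpoch_inf (q / \<zeta>) q * qpoch_inf q q =
     jtp_term \<zeta> q (-2) * \<theta> 1 + jtp_term \<zeta> q (-1) * \<theta> (q ^ 5) +
     jtp_term \<zeta> q 0 * \<theta> (q ^ 10) + jtp_term \<zeta> q 1 * \<theta> (q ^ 15) + jtp_term \<zeta> q 2 * \<theta> (q ^ 20)"
    using LIMSEQ_unique by (simp only:)
  have div: "Q / q ^ 5 = q ^ 20" "Q / q ^ 10 = q ^ 15" "Q / q ^ 15 = q ^ 10" "Q / q ^ 20 = q ^ 5"
    unfolding Q_def using assms by (simp_all flip: power_diff)
  have \<theta>: "\<theta> 1 = 0"
    "\<theta> (q ^ 5) = RR_num (q ^ 5) * euler_prod (q ^ 25)"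
    "\<theta> (q ^ 10) = RR_den (q ^ 5) * euler_prod (q ^ 25)"
    "\<theta> (q ^ 15) = RR_den (q ^ 5) * euler_prod (q ^ 25)"
    "\<theta> (q ^ 20) = RR_num (q ^ 5) * euler_prod (q ^ 25)"
    unfolding \<theta>_def div using Q
    by (simp_all add: qpoch_inf_1 RR_num_def RR_den_def euler_prod_def Q_def mult_ac
        flip: power_mult)
  have t: "jtp_term \<zeta> q (-1) = - q * inverse \<zeta>" "jtp_term \<zeta> q 0 = 1" "jtp_term \<zeta> q 1 = - \<zeta>"
    "jtp_term \<zeta> q 2 = \<zeta>\<^sup>2 * q"
    using z by (simp_all add: jtp_term_def power_int_minus)
  \<comment> \<open>\<open>1 - \<zeta>\<close> is the first factor of
    \<open>qpoch_inf \<zeta> q\<close> and also divides both coefficients on the right, so it can be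
    cancelled.\<close>
  have "(1 - \<zeta>) * (qpoch_inf (\<zeta> * q) q * qpoch_inf (inverse \<zeta> * q) q * euler_prod q) =
    (1 - \<zeta>) * (RR_den (q ^ 5) * euler_prod (q ^ 25)) +
      (\<zeta>\<^sup>2 - inverse \<zeta>) * (q * RR_num (q ^ 5) * euler_prod (q ^ 25))"
    using * unfolding \<theta> t qpoch_inf_step[OF assms(4), of \<zeta>] euler_prod_def
    by (simp add: algebra_simps divide_inverse)
  also have "\<zeta>\<^sup>2 - inverse \<zeta> = (1 - \<zeta>) * (- (1 + \<zeta> + inverse \<zeta>))"
    using z by (simp add: field_simps power2_eq_square)
  also have "RR_num (q ^ 5) = RR_den (q ^ 5) * RR (q ^ 5)"
    using RR_den_nonzero[OF q[of 5]] by (simp add: RR_altdef)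
  finally have "(1 - \<zeta>) * (qpoch_inf (\<zeta> * q) q * qpoch_inf (inverse \<zeta> * q) q * euler_prod q) =
    (1 - \<zeta>) * (RR_den (q ^ 5) * euler_prod (q ^ 25) * (1 - (1 + \<zeta> + inverse \<zeta>) * (q * RR (q ^ 5))))"
    by (simp add: algebra_simps)
  then show ?thesis
    using assms(2) by simp
qed

section \<open>Products over the fifth roots of unity\<close>

lemma prod_one_minus_fifth_roots:
  fixes w x :: complex
  assumes "1 + w + w^2 + w^3 + w^4 = 0"
  shows "(\<Prod>k<5. 1 - w ^ k * x) = 1 - x ^ 5"
proof -
  have "(1 - x) * (1 - w * x) * (1 - w^2 * x) * (1 - w^3 * x) * (1 - w^4 * x) = 1 - x ^ 5"
    using assms by algebra
  then show ?thesis
    by (simp add: eval_nat_numeral lessThan_Suc mult_ac)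
qed

text \<open>Primitivity is expressed by the vanishing of the fifth cyclotomic polynomial, which
  turns these facts into polynomial identities within reach of \<open>algebra\<close>.\<close>

lemma fifth_root_power:
  fixes w :: complex
  assumes "1 + w + w^2 + w^3 + w^4 = 0"
  shows "w ^ 5 = 1" and "j \<in> {1..4} \<Longrightarrow> 1 + w^j + (w^j)^2 + (w^j)^3 + (w^j)^4 = 0"
proof -
  show "w ^ 5 = 1"
    using assms by algebra
  assume "j \<in> {1..4}"
  then have "j = 1 \<or> j = 2 \<or> j = 3 \<or> j = 4" by auto
  moreover have "1 + w^2 + (w^2)^2 + (w^2)^3 + (w^2)^4 = 0"
    "1 + w^3 + (w^3)^2 + (w^3)^3 + (w^3)^4 = 0"  "1 + w^4 + (w^4)^2 + (w^4)^3 + (w^4)^4 = 0"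
    using assms by algebra+
  ultimately show "1 + w^j + (w^j)^2 + (w^j)^3 + (w^j)^4 = 0"
    using assms by auto
qed

text \<open>In the product over the fifth roots \<open>p\<close> of \<open>q\<close>, the factors whose index is prime to 5
  combine to \<open>1 - q ^ n\<close>, while the others occur five times.\<close>

lemma prod_qpoch_twist:
  assumes "c ^ 5 = 1" "1 + w + w^2 + w^3 + w^4 = 0" "norm p < 1" "q = p ^ 5"
  shows "(\<Prod>k<5. qpoch_inf (c * (w ^ k * p)) (w ^ k * p)) * euler_prod (q ^ 5) =
    qpoch_inf (c * q) q ^ 5 * euler_prod q"
proof -
  note w = fifth_root_power[OF assms(2)]
  have nw: "norm w = 1"
    using w(1) by (metis norm_one norm_power norm_ge_zero power_eq_1_iff zero_neq_numeral real_norm_def abs_of_nonneg)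
  have pk: "norm (w ^ k * p) < 1" for k
    using assms nw by (simp add: norm_mult norm_power)
  have q: "norm q < 1" "norm (q ^ 5) < 1"
    using assms norm_power_less_1[of p 5] norm_power_less_1[of p 25] by (auto simp flip: power_mult)
  \<comment> \<open>The twisted product contains \<open>1 - q^n\<close> only for \<open>n\<close>
    prime to 5; the extra factors in powers of \<open>q^5\<close> supply the missing
    \<open>n\<close> and complete the Euler product of \<open>q\<close>.\<close>
  have fin: "(\<Prod>k<5. \<Prod>n<5*M. 1 - c * (w ^ k * p) * (w ^ k * p) ^ n) * (\<Prod>m<M. 1 - q ^ 5 * (q ^ 5) ^ m) =
    (\<Prod>m<M. 1 - c * q * q ^ m) ^ 5 * (\<Prod>n<5*M. 1 - q * q ^ n)" for M
  proof -
    define F where "F = (\<lambda>n. \<Prod>k<5. 1 - c * (w ^ k * p) * (w ^ k * p) ^ n)"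
    have wk: "w ^ (k * n) = (w ^ (n mod 5)) ^ k" for k n
    proof -
      have "w ^ (k * n) = (w ^ (5 * (n div 5) + n mod 5)) ^ k"
        by (simp flip: power_mult add: mult.commute)
      also have "w ^ (5 * (n div 5) + n mod 5) = w ^ (n mod 5)"
        by (simp only: power_add power_mult w(1)) simp
      finally show ?thesis .
    qed
    have F_eq: "F n = (\<Prod>k<5. 1 - (w ^ (Suc n mod 5)) ^ k * (c * p ^ Suc n))" for n
      unfolding F_def
    proof (intro prod.cong refl)
      fix k :: nat
      have "(w ^ k * p) * (w ^ k * p) ^ n = w ^ (k * Suc n) * p ^ Suc n"
        by (simp only: power_Suc power_mult_distrib power_mult mult_ac)
      then have "c * (w ^ k * p) * (w ^ k * p) ^ n = c * (w ^ (k * Suc n) * p ^ Suc n)"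
        by (simp only: mult.assoc)
      then show "1 - c * (w ^ k * p) * (w ^ k * p) ^ n = 1 - (w ^ (Suc n mod 5)) ^ k * (c * p ^ Suc n)"
        unfolding wk by (simp only: mult_ac)
    qed
    \<comment> \<open>Here the powers of \<open>w\<close> run through all fifth roots of unity, so
      the product is \<open>1 - (c * p^(n+1))^5\<close>, from which \<open>c^5 = 1\<close> removes
      \<open>c\<close>.\<close>
    have F1: "F n = 1 - q * q ^ n" if "Suc n mod 5 \<noteq> 0" for n
    proof -
      have "F n = 1 - (c * p ^ Suc n) ^ 5"
        unfolding F_eq using that by (intro prod_one_minus_fifth_roots w) auto
      also have "(c * p ^ Suc n) ^ 5 = c ^ 5 * (p ^ 5) ^ Suc n"
        by (simp only: power_mult_distrib power_mult[symmetric] mult.commute)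
      finally show ?thesis
        using assms by simp
    qed
    have F2: "F (5 * m + 4) = (1 - c * q * q ^ m) ^ 5" for m
    proof -
      have "Suc (5 * m + 4) = 5 * Suc m" by simp
      then have "F (5 * m + 4) = (\<Prod>k<(5::nat). 1 - c * (p ^ 5) ^ Suc m)"
        unfolding F_eq by (simp add: power_mult[symmetric] power_add)
      then show ?thesis
        using assms by (simp add: mult.assoc)
    qed
    have m: "Suc (5 * m) mod 5 \<noteq> 0" "Suc (5 * m + 1) mod 5 \<noteq> 0" "Suc (5 * m + 2) mod 5 \<noteq> 0"
        "Suc (5 * m + 3) mod 5 \<noteq> 0" for m :: nat
      by presburger+
    have q5: "q * q ^ (5 * m + 4) = q ^ 5 * (q ^ 5) ^ m" for m
    proof -
      have "q * q ^ (5 * m + 4) = q ^ (5 + 5 * m)"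
        by (simp only: power_Suc[symmetric]) (simp add: add.commute)
      then show ?thesis
        by (simp only: power_add power_mult)
    qed
    have "(\<Prod>k<5. \<Prod>n<5*M. 1 - c * (w ^ k * p) * (w ^ k * p) ^ n) = (\<Prod>n<5*M. F n)"
      unfolding F_def by (rule prod.swap)
    also have "\<dots> = (\<Prod>m<M. (1 - q * q ^ (5*m)) * (1 - q * q ^ (5*m+1)) * (1 - q * q ^ (5*m+2)) *
        (1 - q * q ^ (5*m+3)) * (1 - c * q * q ^ m) ^ 5)"
      unfolding prod_lessThan_5_mult F2 by (simp only: F1[OF m(1)] F1[OF m(2)] F1[OF m(3)] F1[OF m(4)])
    finally show ?thesis
      unfolding prod_lessThan_5_mult prod_power_distrib q5
      by (simp only: prod.distrib[symmetric] mult_ac)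
  qed
  have 1: "(\<lambda>M. (\<Prod>k<5. \<Prod>n<5*M. 1 - c * (w ^ k * p) * (w ^ k * p) ^ n) * (\<Prod>m<M. 1 - q ^ 5 * (q ^ 5) ^ m))
     \<longlonglongrightarrow> (\<Prod>k<5. qpoch_inf (c * (w ^ k * p)) (w ^ k * p)) * euler_prod (q ^ 5)"
    unfolding euler_prod_def
    by (intro tendsto_mult tendsto_prod qpoch_inf_LIMSEQ q
        filterlim_compose[OF qpoch_inf_LIMSEQ filterlim_times_5] pk)
  have 2: "(\<lambda>M. (\<Prod>m<M. 1 - c * q * q ^ m) ^ 5 * (\<Prod>n<5*M. 1 - q * q ^ n))
     \<longlonglongrightarrow> qpoch_inf (c * q) q ^ 5 * euler_prod q"
    unfolding euler_prod_def
    by (intro tendsto_mult tendsto_power qpoch_inf_LIMSEQ q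
        filterlim_compose[OF qpoch_inf_LIMSEQ filterlim_times_5])
  show ?thesis
    using LIMSEQ_unique[OF 1[unfolded fin] 2] .
qed

section \<open>Ramanujan's relation between \<open>R(q)\<close> and \<open>R(q\<^sup>5)\<close>\<close>

lemma fifth_root_sum:
  fixes \<zeta> :: complex
  assumes "\<zeta> ^ 5 = 1" "\<zeta> \<noteq> 1"
  shows "1 + \<zeta> + \<zeta>^2 + \<zeta>^3 + \<zeta>^4 = 0"
proof -
  have "(\<zeta> - 1) * (1 + \<zeta> + \<zeta>^2 + \<zeta>^3 + \<zeta>^4) = \<zeta> ^ 5 - 1"
    by (simp add: algebra_simps eval_nat_numeral)
  then show ?thesis
    using assms by simp
qed

text \<open>\<open>theta_root_of_unity\<close> is multiplied over the five fifth roots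
  \<open>\<zeta>^k * p\<close> of \<open>q\<close>. \<open>prod_qpoch_twist\<close> evaluates the
  theta side for \<open>c\<close> equal to \<open>\<zeta>\<close>, \<open>inverse \<zeta>\<close>
  and 1, the last being the Euler product. Each use costs a factor
  \<open>euler_prod (q ^ 5)\<close>, whence the exponent 8 = 5 + 3.\<close>

lemma theta_root_of_unity_fifth_power:
  assumes "\<zeta> ^ 5 = 1" "\<zeta> \<noteq> 1" "q \<noteq> 0" "norm q < 1"
  shows "RR_den q ^ 5 * euler_prod (q ^ 5) ^ 8 * (1 - (1 + \<zeta> + inverse \<zeta>) ^ 5 * (q * RR q ^ 5)) =
    (qpoch_inf (\<zeta> * q) q * qpoch_inf (inverse \<zeta> * q) q) ^ 5 * euler_prod q ^ 8"
proof -
  define p where "p = q powr (1/5)"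
  have p: "q = p ^ 5"
    using assms by (simp add: p_def powr_power)
  have p': "p \<noteq> 0" "norm p < 1"
    using assms power_less_one_iff[of "norm p" 5] unfolding p by (auto simp: norm_power)
  have sum0: "1 + \<zeta> + \<zeta>^2 + \<zeta>^3 + \<zeta>^4 = 0"
    using assms by (intro fifth_root_sum)
  have nz: "norm \<zeta> = 1"
    using assms(1) by (metis norm_one norm_power norm_ge_zero power_eq_1_iff zero_neq_numeral real_norm_def abs_of_nonneg)
  then have z: "\<zeta> \<noteq> 0" by auto
  define \<phi> where "\<phi> = 1 + \<zeta> + inverse \<zeta>"
  define P where "P = (\<lambda>c. \<Prod>k<5. qpoch_inf (c * (\<zeta> ^ k * p)) (\<zeta> ^ k * p))"
  have "qpoch_inf (\<zeta> * (\<zeta> ^ k * p)) (\<zeta> ^ k * p) * qpoch_inf (inverse \<zeta> * (\<zeta> ^ k * p)) (\<zeta> ^ k * p) *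
      qpoch_inf (1 * (\<zeta> ^ k * p)) (\<zeta> ^ k * p) =
      RR_den q * euler_prod (q ^ 5) * (1 - \<zeta> ^ k * (\<phi> * (p * RR q)))" for k
  proof -
    have e: "(\<zeta> ^ k * p) ^ 5 = q" "(\<zeta> ^ k * p) ^ 25 = q ^ 5"
    proof -
      show *: "(\<zeta> ^ k * p) ^ 5 = q"
        by (simp only: power_mult_distrib power_mult[symmetric] mult.commute[of k])
           (simp add: power_mult assms p)
      have "(\<zeta> ^ k * p) ^ 25 = ((\<zeta> ^ k * p) ^ 5) ^ 5"
        by (simp flip: power_mult)
      then show "(\<zeta> ^ k * p) ^ 25 = q ^ 5"
        unfolding * .
    qed
    show ?thesis
      using theta_root_of_unity[OF assms(1,2), of "\<zeta> ^ k * p", unfolded e] z p' nz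
      by (simp add: norm_mult norm_power euler_prod_def \<phi>_def mult_ac)
  qed
  then have "P \<zeta> * P (inverse \<zeta>) * P 1 =
      (\<Prod>k<5. RR_den q * euler_prod (q ^ 5) * (1 - \<zeta> ^ k * (\<phi> * (p * RR q))))"
    unfolding P_def prod.distrib[symmetric] by simp
  also have "\<dots> = (RR_den q * euler_prod (q ^ 5)) ^ 5 * (1 - (\<phi> * (p * RR q)) ^ 5)"
    unfolding prod.distrib prod_one_minus_fifth_roots[OF sum0] by (simp add: power_mult_distrib)
  also have "(\<phi> * (p * RR q)) ^ 5 = \<phi> ^ 5 * (q * RR q ^ 5)"
    by (simp add: p power_mult_distrib)
  finally have 1: "P \<zeta> * P (inverse \<zeta>) * P 1 =
      (RR_den q * euler_prod (q ^ 5)) ^ 5 * (1 - \<phi> ^ 5 * (q * RR q ^ 5))" .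
  have 2: "P c * euler_prod (q ^ 5) = qpoch_inf (c * q) q ^ 5 * euler_prod q" if "c ^ 5 = 1" for c
    unfolding P_def by (intro prod_qpoch_twist that sum0 p' p)
  have "RR_den q ^ 5 * euler_prod (q ^ 5) ^ 8 * (1 - \<phi> ^ 5 * (q * RR q ^ 5)) =
      (P \<zeta> * P (inverse \<zeta>) * P 1) * euler_prod (q ^ 5) ^ 3"
    unfolding 1 power_mult_distrib by (simp add: mult_ac flip: power_add)
  also have "\<dots> = (P \<zeta> * euler_prod (q ^ 5)) * (P (inverse \<zeta>) * euler_prod (q ^ 5)) *
       (P 1 * euler_prod (q ^ 5))"
    by (simp add: eval_nat_numeral mult_ac)
  also have "\<dots> = (qpoch_inf (\<zeta> * q) q ^ 5 * euler_prod q) * (qpoch_inf (inverse \<zeta> * q) q ^ 5 * euler_prod q) *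
       (qpoch_inf (1 * q) q ^ 5 * euler_prod q)"
    using assms(1) by (simp only: 2 power_inverse inverse_1 power_one)
  also have "\<dots> = (qpoch_inf (\<zeta> * q) q * qpoch_inf (inverse \<zeta> * q) q) ^ 5 * euler_prod q ^ 8"
    by (simp add: euler_prod_def power_mult_distrib) (simp add: eval_nat_numeral mult_ac)
  finally show ?thesis
    unfolding \<phi>_def .
qed

text \<open>Factors with equal \<open>n\<close> multiply to \<open>1 - (q * q^n)^5\<close>. This
  links the theta functions at \<open>\<zeta>\<close> and \<open>\<zeta>^2\<close>.\<close>

lemma prod_qpoch_fifth_roots:
  assumes "1 + w + w^2 + w^3 + w^4 = 0" "norm q < 1"
  shows "(\<Prod>k<5. qpoch_inf (w ^ k * q) q) = euler_prod (q ^ 5)"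
proof -
  have fin: "(\<Prod>k<5. \<Prod>n<N. 1 - (w ^ k * q) * q ^ n) = (\<Prod>n<N. 1 - q ^ 5 * (q ^ 5) ^ n)" for N
  proof (subst prod.swap, intro prod.cong refl)
    fix n :: nat
    have "(\<Prod>k<5. 1 - w ^ k * (q * q ^ n)) = 1 - (q * q ^ n) ^ 5"
      by (rule prod_one_minus_fifth_roots) fact
    also have "(q * q ^ n) ^ 5 = q ^ 5 * (q ^ 5) ^ n"
      by (simp only: power_mult_distrib power_mult[symmetric] mult.commute)
    finally show "(\<Prod>k<5. 1 - w ^ k * q * q ^ n) = 1 - q ^ 5 * (q ^ 5) ^ n"
      by (simp only: mult.assoc)
  qed
  have "(\<lambda>N. \<Prod>k<5. \<Prod>n<N. 1 - (w ^ k * q) * q ^ n) \<longlonglongrightarrow> (\<Prod>k<5. qpoch_inf (w ^ k * q) q)"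
    by (intro tendsto_prod qpoch_inf_LIMSEQ assms)
  moreover have "(\<lambda>N. \<Prod>n<N. 1 - q ^ 5 * (q ^ 5) ^ n) \<longlonglongrightarrow> euler_prod (q ^ 5)"
    unfolding euler_prod_def by (intro qpoch_inf_LIMSEQ norm_power_less_1 assms) auto
  ultimately show ?thesis
    unfolding fin using LIMSEQ_unique by blast
qed

lemma RR_modular_relations:
  assumes "q \<noteq> 0" "norm q < 1"
  defines "u \<equiv> q * RR q ^ 5" and "v \<equiv> q * RR (q ^ 5)"
  shows "u * (1 + 3 * v + 4 * v^2 + 2 * v^3 + v^4) = v * (1 - 2 * v + 4 * v^2 - 3 * v^3 + v^4)"
    and "1 - 11 * u - u ^ 2 = RR_num q ^ 11 * RR_den q"
proof -
  define \<zeta> :: complex where "\<zeta> = cis (2 * pi / 5)"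
  have \<zeta>: "\<zeta> ^ 5 = 1"
    unfolding \<zeta>_def Complex.DeMoivre by simp
  have \<zeta>1: "\<zeta> \<noteq> 1"
  proof
    assume "\<zeta> = 1"
    then have "sin (2 * pi / 5) = 0"
      by (simp add: \<zeta>_def complex_eq_iff)
    moreover have "sin (2 * pi / 5) > 0"
      by (intro sin_gt_zero) auto
    ultimately show False by simp
  qed
  have sum0: "1 + \<zeta> + \<zeta>^2 + \<zeta>^3 + \<zeta>^4 = 0"
    using \<zeta> \<zeta>1 by (rule fifth_root_sum)
  have \<zeta>2: "(\<zeta>^2) ^ 5 = 1" "\<zeta>^2 \<noteq> 1"
  proof -
    show *: "(\<zeta>^2) ^ 5 = 1"
      using \<zeta> by (metis power_mult mult.commute power_one)
    show "\<zeta>^2 \<noteq> 1"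
      using \<zeta> \<zeta>1 by algebra
  qed
  have inv: "inverse \<zeta> = \<zeta>^4" "inverse (\<zeta>^2) = \<zeta>^3"
    using \<zeta> by (auto intro!: inverse_unique simp flip: power_Suc power_add)
  \<comment> \<open>\<open>f\<close> is the golden ratio \<open>1 + 2 cos (2 pi / 5)\<close> and
    \<open>f'\<close> its conjugate.\<close>
  define f f' where "f = 1 + \<zeta> + \<zeta>^4" and "f' = 1 + \<zeta>^2 + \<zeta>^3"
  have ff: "f + f' = 1" "f * f' = -1"
    unfolding f_def f'_def using sum0 by algebra+
  have f_ne: "f \<noteq> f'"
  proof -
    have "(f - f')^2 = 5"
      using ff by algebra
    then show ?thesis by auto
  qed
  define T T' where "T = qpoch_inf (\<zeta> * q) q * qpoch_inf (\<zeta>^4 * q) q"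
    and "T' = qpoch_inf (\<zeta>^2 * q) q * qpoch_inf (\<zeta>^3 * q) q"
  define e e5 where "e = euler_prod q" and "e5 = euler_prod (q ^ 5)"
  define C where "C = RR_den (q ^ 5) * euler_prod (q ^ 25)"
  have q: "norm (q ^ n) < 1" if "n > 0" for n
    using assms that by (intro norm_power_less_1)
  have nz: "e \<noteq> 0" "e5 \<noteq> 0" "C \<noteq> 0" "RR_den q \<noteq> 0"
    using q[of 5] q[of 25] assms by (simp_all add: e_def e5_def C_def euler_prod_nonzero RR_den_nonzero)
  have 1: "T * e = C * (1 - f * v)" "T' * e = C * (1 - f' * v)"
    using theta_root_of_unity[OF \<zeta> \<zeta>1 assms(1,2)] theta_root_of_unity[OF \<zeta>2 assms(1,2)]
    unfolding inv T_def T'_def e_def C_def f_def f'_def v_def by simp_all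
  have 2: "RR_den q ^ 5 * e5 ^ 8 * (1 - f ^ 5 * u) = T ^ 5 * e ^ 8"
     "RR_den q ^ 5 * e5 ^ 8 * (1 - f' ^ 5 * u) = T' ^ 5 * e ^ 8"
    using theta_root_of_unity_fifth_power[OF \<zeta> \<zeta>1 assms(1,2)]
      theta_root_of_unity_fifth_power[OF \<zeta>2 assms(1,2)]
    unfolding inv T_def T'_def e_def e5_def f_def f'_def u_def by simp_all
  have 3: "T * T' * e = e5"
    using prod_qpoch_fifth_roots[OF sum0 assms(2)]
    unfolding T_def T'_def e_def e5_def euler_prod_def
    by (simp add: eval_nat_numeral lessThan_Suc mult_ac)
  \<comment> \<open>\<open>T^5 * T'^5 * e^13\<close> is evaluated in two ways, taking one fifth
    power from \<open>2\<close> and the other from \<open>1\<close>. This eliminates the theta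
    functions and leaves a relation between \<open>u\<close> and \<open>v\<close>.\<close>
  have "RR_den q ^ 5 * e5 ^ 8 * C ^ 5 * ((1 - f ^ 5 * u) * (1 - f' * v) ^ 5) =
      (RR_den q ^ 5 * e5 ^ 8 * (1 - f ^ 5 * u)) * (C * (1 - f' * v)) ^ 5"
    by (simp add: power_mult_distrib mult_ac)
  also have "\<dots> = (RR_den q ^ 5 * e5 ^ 8 * (1 - f' ^ 5 * u)) * (C * (1 - f * v)) ^ 5"
    unfolding 2 1[symmetric] by (simp add: power_mult_distrib mult_ac)
  also have "\<dots> = RR_den q ^ 5 * e5 ^ 8 * C ^ 5 * ((1 - f' ^ 5 * u) * (1 - f * v) ^ 5)"
    by (simp add: power_mult_distrib mult_ac)
  finally have 4: "(1 - f ^ 5 * u) * (1 - f' * v) ^ 5 = (1 - f' ^ 5 * u) * (1 - f * v) ^ 5"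
    using nz by simp
  \<comment> \<open>Powers of a root of \<open>x^2 = x + 1\<close> are linear in \<open>x\<close>
    with Fibonacci coefficients.\<close>
  have fib: "x^2 = x + 1" "x^3 = 2 * x + 1" "x^4 = 3 * x + 2" "x^5 = 5 * x + 3" if "x = f \<or> x = f'" for x
  proof -
    have "f^2 = f + 1" "f'^2 = f' + 1"
      using ff by algebra+
    then show 2: "x^2 = x + 1"
      using that by auto
    show "x^3 = 2 * x + 1" "x^4 = 3 * x + 2" "x^5 = 5 * x + 3"
      using 2 by algebra+
  qed
  have pow5: "(1 - x * v)^5 = 1 - 5 * x * v + 10 * (x + 1) * v^2 - 10 * (2 * x + 1) * v^3 +
      5 * (3 * x + 2) * v^4 - (5 * x + 3) * v^5" if "x = f \<or> x = f'" for x
  proof -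
    have "(1 - x * v)^5 = 1 - 5 * x * v + 10 * x^2 * v^2 - 10 * x^3 * v^3 + 5 * x^4 * v^4 - x^5 * v^5"
      by algebra
    then show ?thesis
      unfolding fib[OF that] .
  qed
  have f': "f' = 1 - f"
    using ff by algebra
  have 4: "(1 - (5 * f + 3) * u) * (1 - f' * v) ^ 5 = (1 - (5 * f' + 3) * u) * (1 - f * v) ^ 5"
    using 4 by (simp add: fib)
  \<comment> \<open>The difference of the two sides of \<open>4\<close> changes sign when
    \<open>f\<close> and \<open>f'\<close> are swapped, so \<open>f - f'\<close> splits off.\<close>
  have "5 * (f - f') * (u * (1 + 3 * v + 4 * v^2 + 2 * v^3 + v^4) -
      v * (1 - 2 * v + 4 * v^2 - 3 * v^3 + v^4)) = 0"
    using 4 fib(1)[of f] unfolding pow5[of f, simplified] pow5[of f', simplified] f' by algebra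
  then show "u * (1 + 3 * v + 4 * v^2 + 2 * v^3 + v^4) = v * (1 - 2 * v + 4 * v^2 - 3 * v^3 + v^4)"
    using f_ne by simp
  have e: "e = RR_num q * RR_den q * e5"
    unfolding e_def e5_def by (rule euler_prod_eq) fact
  \<comment> \<open>The product of the two identities in \<open>2\<close> is now used: 11 is a Lucas
    number, and \<open>T * T' * e = e5\<close> removes the theta functions.\<close>
  have "f ^ 5 + f' ^ 5 = 11" "(f * f') ^ 5 = -1"
    using ff(2) by (simp_all add: fib f')
  moreover have "(1 - f ^ 5 * u) * (1 - f' ^ 5 * u) = 1 - (f ^ 5 + f' ^ 5) * u + (f * f') ^ 5 * u ^ 2"
    by (simp add: power_mult_distrib algebra_simps power2_eq_square)
  ultimately have 5: "(1 - f ^ 5 * u) * (1 - f' ^ 5 * u) = 1 - 11 * u - u ^ 2"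
    by simp
  have "(RR_den q ^ 10 * e5 ^ 16) * (1 - 11 * u - u ^ 2) =
      (RR_den q ^ 5 * e5 ^ 8 * (1 - f ^ 5 * u)) * (RR_den q ^ 5 * e5 ^ 8 * (1 - f' ^ 5 * u))"
    unfolding 5[symmetric] by algebra
  also have "\<dots> = (T * T' * e) ^ 5 * e ^ 11"
    unfolding 2 by algebra
  also have "\<dots> = (RR_den q ^ 10 * e5 ^ 16) * (RR_num q ^ 11 * RR_den q)"
    unfolding 3 unfolding e by algebra
  finally show "1 - 11 * u - u ^ 2 = RR_num q ^ 11 * RR_den q"
    using nz by simp
qed

text \<open>Over the denominator \<open>1 - 11 * v^5 - v^10 = 1 / (a^11 * b)\<close> the quotient
  has a polynomial numerator in \<open>v = q * b / a\<close>. As \<open>a\<close> and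
  \<open>b\<close> depend on \<open>q^5\<close> only, \<open>v^i\<close> contributes just to the
  residue of \<open>i\<close> modulo 5.\<close>

theorem RR_quotient_dissection:
  assumes "q \<noteq> 0" "norm q < 1"
  defines "a \<equiv> inverse (RR_num (q ^ 5))" and "b \<equiv> inverse (RR_den (q ^ 5))"
  shows "RR (q ^ 5) / RR q ^ 5 =
    1 - 25 * q^5 * (a^6 * b^6) + 5 * q * (a^10 * b^2 - 8 * q^5 * (a^5 * b^7)) +
    10 * q^2 * (a^9 * b^3 - 3 * q^5 * (a^4 * b^8)) +
    5 * q^3 * (a^8 * b^4 - 3 * q^5 * (a^3 * b^9)) -
    5 * q^4 * (3 * (a^7 * b^5) + q^5 * (a^2 * b^10))"
proof -
  have q5: "q ^ 5 \<noteq> 0" "norm (q ^ 5) < 1"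
    using assms norm_power_less_1[of q 5] by auto
  define u v where "u = q * RR q ^ 5" and "v = q * RR (q ^ 5)"
  have ab: "a \<noteq> 0" "b \<noteq> 0"
    unfolding a_def b_def using q5 by (simp_all add: RR_num_nonzero RR_den_nonzero)
  have v: "v * a = q * b"
    unfolding v_def RR_altdef using RR_num_nonzero[OF q5(2)] by (simp add: a_def b_def field_simps)
  have uv: "u * (1 + 3 * v + 4 * v^2 + 2 * v^3 + v^4) = v * (1 - 2 * v + 4 * v^2 - 3 * v^3 + v^4)"
    unfolding u_def v_def using assms by (intro RR_modular_relations)
  \<comment> \<open>The second modular relation at \<open>q^5\<close>, where \<open>u\<close>
    becomes \<open>v^5\<close>.\<close>
  have "1 - 11 * v^5 - v^10 = RR_num (q ^ 5) ^ 11 * RR_den (q ^ 5)"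
    using RR_modular_relations(2)[OF q5] by (simp add: v_def power_mult_distrib flip: power_mult)
  then have d: "(1 - 11 * v^5 - v^10) * (a^11 * b) = 1"
    using ab by (simp add: a_def b_def power_inverse field_simps)
  have u0: "u \<noteq> 0"
    unfolding u_def using assms by (simp add: RR_altdef RR_num_nonzero RR_den_nonzero)
  have "RR (q ^ 5) / RR q ^ 5 = v / u"
    unfolding u_def v_def using assms by simp
  also have "\<dots> = (1 - v - v^2) * (1 + 3 * v + 4 * v^2 + 2 * v^3 + v^4)^2 * (a^11 * b)"
  proof -
    have "(1 - v - v^2) * (1 + 3 * v + 4 * v^2 + 2 * v^3 + v^4)^2 * (a^11 * b) * u = v"
    proof -
      define P Q where "P = 1 + 3 * v + 4 * v^2 + 2 * v^3 + v^4" and "Q = 1 - 2 * v + 4 * v^2 - 3 * v^3 + v^4"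
      \<comment> \<open>\<open>u * P = v * Q\<close> gives \<open>v / u = P / Q\<close>, and the
        factor \<open>(1 - v - v^2) * P\<close> completes \<open>Q\<close> to the known
        denominator.\<close>
      have "(1 - v - v^2) * P * Q = 1 - 11 * v^5 - v^10"
        unfolding P_def Q_def by algebra
      then have "(1 - v - v^2) * P * (v * Q) * (a^11 * b) = v"
        using d by algebra
      then show ?thesis
        unfolding uv[folded P_def Q_def, symmetric] P_def[symmetric] by (simp add: power2_eq_square mult_ac)
    qed
    then show ?thesis
      using u0 by (simp add: field_simps)
  qed
  \<comment> \<open>Splitting the denominator off the numerator isolates the constant 1, the source
    of the exceptional value \<open>D 0\<close>.\<close>
  also have "\<dots> = (1 - 11 * v^5 - v^10) * (a^11 * b) +
    (- 25 * v^5 + 5 * v - 40 * v^6 + 10 * v^2 - 30 * v^7 + 5 * v^3 - 15 * v^8 - 15 * v^4 - 5 * v^9) * (a^11 * b)"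
    by algebra
  also have "\<dots> = 1 - 25 * ((v * a)^5 * a^6 * b) + 5 * (v * a * a^10 * b) - 40 * ((v * a)^6 * a^5 * b) +
     10 * ((v * a)^2 * a^9 * b) - 30 * ((v * a)^7 * a^4 * b) + 5 * ((v * a)^3 * a^8 * b) -
     15 * ((v * a)^8 * a^3 * b) - 15 * ((v * a)^4 * a^7 * b) - 5 * ((v * a)^9 * a^2 * b)"
    unfolding d by algebra
  also have "\<dots> = 1 - 25 * q^5 * (a^6 * b^6) + 5 * q * (a^10 * b^2 - 8 * q^5 * (a^5 * b^7)) +
    10 * q^2 * (a^9 * b^3 - 3 * q^5 * (a^4 * b^8)) +
    5 * q^3 * (a^8 * b^4 - 3 * q^5 * (a^3 * b^9)) -
    5 * q^4 * (3 * (a^7 * b^5) + q^5 * (a^2 * b^10))"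
    unfolding v by algebra
  finally show ?thesis .
qed

section \<open>Power series with nonnegative integer coefficients\<close>

text \<open>Coefficients stay complex so that the same series can be evaluated as analytic
  functions; membership in \<open>\<nat>\<close> records integrality and nonnegativity at
  once.\<close>

definition nat_fps :: "complex fps \<Rightarrow> bool" where
  "nat_fps F \<longleftrightarrow> (\<forall>n. fps_nth F n \<in> \<nat>)"

lemma nat_fps_1: "nat_fps 1"
  and nat_fps_X: "nat_fps fps_X"
  by (auto simp: nat_fps_def fps_X_def)

lemma nat_fps_numeral: "nat_fps (numeral k)"
  unfolding nat_fps_def by (auto simp: numeral_fps_const)

lemma nat_fps_add: "nat_fps F \<Longrightarrow> nat_fps G \<Longrightarrow> nat_fps (F + G)"
  by (auto simp: nat_fps_def)

lemma sum_in_Nats: "(\<And>x. x \<in> A \<Longrightarrow> f x \<in> \<nat>) \<Longrightarrow> sum f A \<in> \<nat>"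
  by (induction A rule: infinite_finite_induct) auto

lemma nat_fps_mult: "nat_fps F \<Longrightarrow> nat_fps G \<Longrightarrow> nat_fps (F * G)"
  by (auto simp: nat_fps_def fps_mult_nth intro!: sum_in_Nats)

lemma nat_fps_power: "nat_fps F \<Longrightarrow> nat_fps (F ^ n)"
  by (induction n) (auto intro: nat_fps_1 nat_fps_mult)

lemma nat_fps_prod: "(\<And>k. k \<in> A \<Longrightarrow> nat_fps (F k)) \<Longrightarrow> nat_fps (\<Prod>k\<in>A. F k)"
  by (induction A rule: infinite_finite_induct) (auto intro: nat_fps_1 nat_fps_mult)

lemmas nat_fps_intros =
  nat_fps_1 nat_fps_X nat_fps_numeral nat_fps_add nat_fps_mult nat_fps_power nat_fps_prod

definition fps_geo :: "nat \<Rightarrow> complex fps" where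
  "fps_geo m = inverse (1 - fps_X ^ m)"

lemma fps_geo_mult: "m > 0 \<Longrightarrow> (1 - fps_X ^ m) * fps_geo m = 1"
  unfolding fps_geo_def by (rule inverse_mult_eq_1') simp

lemma nat_fps_geo:
  assumes "m > 0"
  shows "nat_fps (fps_geo m)"
proof -
  define G :: "complex fps" where "G = Abs_fps (\<lambda>n. if m dvd n then 1 else 0)"
  have "(1 - fps_X ^ m) * G = 1"
  proof (rule fps_ext)
    fix n
    have "(1 - fps_X ^ m) * G = G - fps_X ^ m * G"
      by (simp add: algebra_simps)
    then show "fps_nth ((1 - fps_X ^ m) * G) n = fps_nth 1 n"
      using assms by (auto simp: G_def fps_X_power_mult_nth dvd_minus_self dest: dvd_imp_le)
  qed
  then have "fps_geo m = G"
    using fps_geo_mult[OF assms] by (metis mult.commute mult.left_commute mult.right_neutral)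
  then show ?thesis
    by (auto simp: nat_fps_def G_def)
qed

definition fps_tendsto :: "(nat \<Rightarrow> complex fps) \<Rightarrow> complex fps \<Rightarrow> bool" where
  "fps_tendsto F G \<longleftrightarrow> (\<forall>n. (\<lambda>N. fps_nth (F N) n) \<longlonglongrightarrow> fps_nth G n)"

lemma fps_tendsto_const: "fps_tendsto (\<lambda>N. F) F"
  by (simp add: fps_tendsto_def)

lemma fps_tendsto_diff: "fps_tendsto F f \<Longrightarrow> fps_tendsto G g \<Longrightarrow> fps_tendsto (\<lambda>N. F N - G N) (f - g)"
  by (auto simp: fps_tendsto_def intro!: tendsto_diff)

lemma fps_tendsto_mult: "fps_tendsto F f \<Longrightarrow> fps_tendsto G g \<Longrightarrow> fps_tendsto (\<lambda>N. F N * G N) (f * g)"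
  by (auto simp: fps_tendsto_def fps_mult_nth intro!: tendsto_sum tendsto_mult)

lemma fps_tendsto_power: "fps_tendsto F f \<Longrightarrow> fps_tendsto (\<lambda>N. F N ^ k) (f ^ k)"
  by (induction k) (auto intro: fps_tendsto_const fps_tendsto_mult)

lemmas fps_tendsto_intros = fps_tendsto_const fps_tendsto_diff fps_tendsto_mult fps_tendsto_power

text \<open>\<open>\<nat>\<close> is closed in the complex plane. The hypothesis starts at
  \<open>Suc N\<close> because the positivity results rely on the first block of the truncated
  products.\<close>

lemma fps_tendsto_nat_fps:
  assumes "fps_tendsto F G" "\<And>N. nat_fps (F (Suc N))"
  shows "nat_fps G"
  unfolding nat_fps_def
proof
  fix n
  have "(\<lambda>N. fps_nth (F (Suc N)) n) \<longlonglongrightarrow> fps_nth G n"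
    using assms(1) unfolding fps_tendsto_def by (intro LIMSEQ_Suc) auto
  then show "fps_nth G n \<in> \<nat>"
    by (rule Lim_in_closed_set[OF closed_Nats, rotated 2])
       (use assms(2) in \<open>auto simp: nat_fps_def\<close>)
qed

section \<open>Reciprocals of infinite products as power series\<close>

lemma inverse_qpoch_uniform_limit:
  assumes "i > 0" "r < 1"
  shows "uniform_limit (cball 0 r) (\<lambda>N z. \<Prod>k<N. inverse (1 - z ^ (i + 5 * k)))
    (\<lambda>z. inverse (qpoch_inf (z ^ i) (z ^ 5))) sequentially"
proof -
  have nz: "1 - z ^ (i + 5 * k) \<noteq> 0" if "z \<in> cball 0 r" for z :: complex and k
    using that assms by (intro one_minus_nonzero norm_power_less_1) auto
  \<comment> \<open>Majorant for the Weierstrass test: for \<open>w = z^(i + 5 * k)\<close>,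
    \<open>1 / (1 - w) - 1 = w / (1 - w)\<close> with \<open>|w| \<le> r^k\<close> and
    \<open>|1 - w| \<ge> 1 - r\<close>.\<close>
  have bound: "norm (inverse (1 - z ^ (i + 5 * k)) - 1) \<le> r ^ k / (1 - r)" if "z \<in> cball 0 r" for z :: complex and k
  proof -
    have z: "norm z \<le> r" "norm z < 1" "0 \<le> r"
      using that assms by (auto intro: order_trans[OF norm_ge_zero])
    have le: "norm z ^ (i + 5 * k) \<le> norm z ^ 1" "norm z ^ (i + 5 * k) \<le> norm z ^ k"
      using z assms by (intro power_decreasing; simp)+
    have "norm z ^ k \<le> r ^ k"
      using z by (intro power_mono) auto
    with le have num: "norm z ^ (i + 5 * k) \<le> r ^ k"
      by linarith
    have "1 - r \<le> 1 - norm (z ^ (i + 5 * k))"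
      using le(1) z by (simp add: norm_power)
    also have "\<dots> \<le> norm (1 - z ^ (i + 5 * k))"
      by (metis norm_one norm_triangle_ineq2)
    finally have den: "1 - r \<le> norm (1 - z ^ (i + 5 * k))" .
    have "inverse (1 - z ^ (i + 5 * k)) - 1 = z ^ (i + 5 * k) / (1 - z ^ (i + 5 * k))"
      using nz[OF that, of k] by (simp add: field_simps)
    also have "norm \<dots> = norm z ^ (i + 5 * k) / norm (1 - z ^ (i + 5 * k))"
      by (simp add: norm_divide norm_power)
    also have "\<dots> \<le> r ^ k / (1 - r)"
      using num den assms z by (intro frac_le) auto
    finally show ?thesis .
  qed
  have "uniformly_convergent_on (cball 0 r) (\<lambda>N z. \<Prod>k<N. inverse (1 - z ^ (i + 5 * k) :: complex))"
  proof (rule uniformly_convergent_on_prod')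
    show "continuous_on (cball 0 r) (\<lambda>z. inverse (1 - z ^ (i + 5 * k) :: complex))" for k
      using nz by (intro continuous_intros) auto
    show "uniformly_convergent_on (cball 0 r)
        (\<lambda>N z. \<Sum>k<N. norm (inverse (1 - z ^ (i + 5 * k) :: complex) - 1))"
    proof (cases "r \<ge> 0")
      case True
      show ?thesis
      proof (rule Weierstrass_m_test')
        show "summable (\<lambda>k. r ^ k / (1 - r))"
          using True assms by (intro summable_divide summable_geometric) auto
      qed (use bound in auto)
    qed (auto simp: uniformly_convergent_on_def)
  qed auto
  then obtain L :: "complex \<Rightarrow> complex" where L: "uniform_limit (cball 0 r) (\<lambda>N z. \<Prod>k<N. inverse (1 - z ^ (i + 5 * k))) L sequentially"
    by (auto simp: uniformly_convergent_on_def)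
  also have "?this \<longleftrightarrow> ?thesis"
  proof (rule uniform_limit_cong')
    fix z :: complex assume z: "z \<in> cball 0 r"
    then have z': "norm (z ^ i) < 1" "norm (z ^ 5) < 1"
      using assms by (auto intro!: norm_power_less_1)
    have "(\<lambda>N. inverse (\<Prod>k<N. 1 - z ^ i * (z ^ 5) ^ k)) \<longlonglongrightarrow> inverse (qpoch_inf (z ^ i) (z ^ 5))"
      by (intro tendsto_inverse qpoch_inf_LIMSEQ qpoch_inf_nonzero z')
    also have "(\<lambda>N. inverse (\<Prod>k<N. 1 - z ^ i * (z ^ 5) ^ k)) = (\<lambda>N. \<Prod>k<N. inverse (1 - z ^ (i + 5 * k)))"
      by (simp add: power_add power_mult prod_inversef[symmetric] comp_def)
    finally show "L z = inverse (qpoch_inf (z ^ i) (z ^ 5))"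
      using tendsto_uniform_limitI[OF L z] LIMSEQ_unique by blast
  qed auto
  finally show ?thesis .
qed

definition qpoch_inv_fps :: "nat \<Rightarrow> complex fps" where
  "qpoch_inv_fps i = fps_expansion (\<lambda>z. inverse (qpoch_inf (z ^ i) (z ^ 5))) 0"

text \<open>A locally uniform limit of holomorphic functions is holomorphic and its derivatives at 0
  are the limits of theirs. So the Taylor series converges on the unit disc and is the
  coefficientwise limit of finite products of geometric series.\<close>

lemma
  assumes "i > 0"
  shows fps_conv_radius_qpoch_inv: "fps_conv_radius (qpoch_inv_fps i) \<ge> 1"
    and eval_fps_qpoch_inv: "norm z < 1 \<Longrightarrow> eval_fps (qpoch_inv_fps i) z = inverse (qpoch_inf (z ^ i) (z ^ 5))"
    and fps_tendsto_qpoch_inv: "fps_tendsto (\<lambda>N. \<Prod>k<N. fps_geo (i + 5 * k)) (qpoch_inv_fps i)"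
proof -
  let ?f = "\<lambda>z. inverse (qpoch_inf (z ^ i) (z ^ 5))"
  let ?g = "\<lambda>N z. \<Prod>k<N. inverse (1 - z ^ (i + 5 * k) :: complex)"
  have nz: "1 - z ^ (i + 5 * k) \<noteq> 0" if "norm z < 1" for z :: complex and k
    using that assms by (intro one_minus_nonzero norm_power_less_1) auto
  have holo_g: "?g N holomorphic_on ball 0 1" for N
    using nz by (intro holomorphic_intros) auto
  have holo: "?f holomorphic_on ball 0 1"
  proof (rule holomorphic_uniform_sequence)
    show "?g N holomorphic_on ball 0 1" for N
      by (rule holo_g)
    fix z :: complex assume "z \<in> ball 0 1"
    then have z: "norm z < 1" by simp
    define d where "d = (1 - norm z) / 2"
    have sub: "cball z d \<subseteq> cball 0 (norm z + d)"
    proof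
      fix x assume "x \<in> cball z d"
      then show "x \<in> cball 0 (norm z + d)"
        using norm_triangle_sub[of x z] by (simp add: dist_norm norm_minus_commute)
    qed
    have lt: "norm z + d < 1"
      using z by (simp add: d_def field_simps)
    have "cball 0 (norm z + d) \<subseteq> ball (0::complex) 1"
      using lt by auto
    then show "\<exists>d>0. cball z d \<subseteq> ball 0 1 \<and> uniform_limit (cball z d) ?g ?f sequentially"
      using z sub uniform_limit_on_subset[OF inverse_qpoch_uniform_limit[OF assms lt] sub]
      by (intro exI[of _ d]) (auto simp: d_def)
  qed auto
  then have holo': "?f holomorphic_on eball 0 (ereal 1)"
    by simp
  show "fps_conv_radius (qpoch_inv_fps i) \<ge> 1"
    using conv_radius_fps_expansion[OF holo'] by (simp add: qpoch_inv_fps_def one_ereal_def)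
  show "eval_fps (qpoch_inv_fps i) z = ?f z" if "norm z < 1"
    using eval_fps_expansion'[OF holo', of z] that by (simp add: qpoch_inv_fps_def)
  show "fps_tendsto (\<lambda>N. \<Prod>k<N. fps_geo (i + 5 * k)) (qpoch_inv_fps i)"
    unfolding fps_tendsto_def
  proof
    fix n
    have "?g N has_fps_expansion (\<Prod>k<N. fps_geo (i + 5 * k))" for N
    proof (rule has_fps_expansion_prod)
      fix k
      have "(\<lambda>z::complex. z ^ (i + 5 * k)) has_fps_expansion fps_X ^ (i + 5 * k)"
        by (rule has_fps_expansion_fps_X_power)
      then show "(\<lambda>z::complex. inverse (1 - z ^ (i + 5 * k))) has_fps_expansion fps_geo (i + 5 * k)"
        unfolding fps_geo_def using assms
        by (intro has_fps_expansion_inverse has_fps_expansion_diff has_fps_expansion_1) auto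
    qed
    then have 1: "fps_nth (\<Prod>k<N. fps_geo (i + 5 * k)) n = (deriv ^^ n) (?g N) 0 / fact n" for N
      by (rule fps_nth_fps_expansion)
    have 2: "fps_nth (qpoch_inv_fps i) n = (deriv ^^ n) ?f 0 / fact n"
      by (simp add: qpoch_inv_fps_def fps_expansion_def)
    have "(\<lambda>N. (deriv ^^ n) (?g N) 0) \<longlonglongrightarrow> (deriv ^^ n) ?f 0"
    proof (rule higher_deriv_complex_uniform_limit)
      show "uniform_limit (ball 0 (1/2)) ?g ?f sequentially"
        using inverse_qpoch_uniform_limit[OF assms, of "1/2"] by (rule uniform_limit_on_subset) auto
      show "\<forall>\<^sub>F N in sequentially. ?g N holomorphic_on ball 0 (1/2)"
        by (intro always_eventually allI holomorphic_on_subset[OF holo_g]) auto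
    qed auto
    then show "(\<lambda>N. fps_nth (\<Prod>k<N. fps_geo (i + 5 * k)) n) \<longlonglongrightarrow> fps_nth (qpoch_inv_fps i) n"
      unfolding 1 2 by (intro tendsto_divide) auto
  qed
qed

section \<open>Positivity of the dissected series\<close>

text \<open>Truncations of the reciprocal of \<open>RR_num\<close>, not of \<open>RR_num\<close>
  itself.\<close>

definition num_fps :: "nat \<Rightarrow> complex fps" where
  "num_fps N = (\<Prod>k<N. fps_geo (1 + 5 * k)) * (\<Prod>k<N. fps_geo (4 + 5 * k))"

definition den_fps :: "nat \<Rightarrow> complex fps" where
  "den_fps N = (\<Prod>k<N. fps_geo (2 + 5 * k)) * (\<Prod>k<N. fps_geo (3 + 5 * k))"

lemma num_fps_Suc: "num_fps (Suc N) = num_fps N * (fps_geo (1 + 5 * N) * fps_geo (4 + 5 * N))"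
  and den_fps_Suc: "den_fps (Suc N) = den_fps N * (fps_geo (2 + 5 * N) * fps_geo (3 + 5 * N))"
  by (simp_all add: num_fps_def den_fps_def mult_ac)

text \<open>Exposes the factors \<open>1 / (1 - q)\<close> and \<open>1 / (1 - q^2)\<close> of the
  first block, to be spent in the positivity arguments.\<close>

lemma num_fps_factor: "\<exists>F. nat_fps F \<and> num_fps (Suc N) = fps_geo 1 * F"
  and den_fps_factor: "\<exists>F. nat_fps F \<and> den_fps (Suc N) = fps_geo 2 * F"
proof -
  show "\<exists>F. nat_fps F \<and> num_fps (Suc N) = fps_geo 1 * F"
    unfolding num_fps_def prod.lessThan_Suc_shift[of _ N, of "\<lambda>k. fps_geo (1 + 5 * k)"]
    by (intro exI[of _ "(\<Prod>k<N. fps_geo (1 + 5 * Suc k)) * (\<Prod>k<Suc N. fps_geo (4 + 5 * k))"])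
       (auto intro!: nat_fps_intros nat_fps_geo simp: mult_ac)
  show "\<exists>F. nat_fps F \<and> den_fps (Suc N) = fps_geo 2 * F"
    unfolding den_fps_def prod.lessThan_Suc_shift[of _ N, of "\<lambda>k. fps_geo (2 + 5 * k)"]
    by (intro exI[of _ "(\<Prod>k<N. fps_geo (2 + 5 * Suc k)) * (\<Prod>k<Suc N. fps_geo (3 + 5 * k))"])
       (auto intro!: nat_fps_intros nat_fps_geo simp: mult_ac)
qed

lemma nat_fps_num_fps: "nat_fps (num_fps N)"
  and nat_fps_den_fps: "nat_fps (den_fps N)"
  unfolding num_fps_def den_fps_def by (auto intro!: nat_fps_intros nat_fps_geo)

text \<open>The numerators of \<open>1 / ((1 - q ^ (5N+1)) (1 - q ^ (5N+4)))\<close> and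
  \<open>1 / ((1 - q ^ (5N+2)) (1 - q ^ (5N+3)))\<close> over the common denominator differ by
  \<open>q ^ (5N+1) (1 - q) (1 - q\<^sup>2)\<close>.\<close>

lemma nat_fps_geo_diff:
  "nat_fps (fps_geo 1 * fps_geo 2 *
     (fps_geo (1 + 5 * N) * fps_geo (4 + 5 * N) - fps_geo (2 + 5 * N) * fps_geo (3 + 5 * N)))"
proof -
  define p :: "complex fps" where "p = fps_X ^ (5 * N)"
  define X :: "complex fps" where "X = fps_X"
  define g where "g = (\<lambda>i. fps_geo (i + 5 * N))"
  have g: "(1 - X ^ i * p) * g i = 1" if "i > 0" for i
    using fps_geo_mult[of "i + 5 * N"] that by (simp add: g_def p_def X_def power_add)
  have g12: "(1 - X) * fps_geo 1 = 1" "(1 - X^2) * fps_geo 2 = 1"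
    using fps_geo_mult[of 1] fps_geo_mult[of 2] by (simp_all add: X_def)
  have "g 1 * g 4 - g 2 * g 3 =
    g 1 * g 4 * ((1 - X^2 * p) * g 2) * ((1 - X^3 * p) * g 3) -
    g 2 * g 3 * ((1 - X^1 * p) * g 1) * ((1 - X^4 * p) * g 4)"
    by (simp only: g zero_less_one zero_less_numeral mult_1_right)
  also have "\<dots> = (1 - X) * (1 - X^2) * (X * p * (g 1 * g 2 * g 3 * g 4))"
    by algebra
  finally have "fps_geo 1 * fps_geo 2 * (g 1 * g 4 - g 2 * g 3) =
     ((1 - X) * fps_geo 1) * ((1 - X^2) * fps_geo 2) * (X * p * (g 1 * g 2 * g 3 * g 4))"
    by (simp only: mult_ac)
  then have "fps_geo 1 * fps_geo 2 * (g 1 * g 4 - g 2 * g 3) = X * p * (g 1 * g 2 * g 3 * g 4)"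
    by (simp only: g12 mult_1)
  moreover have "nat_fps (X * p * (g 1 * g 2 * g 3 * g 4))"
    unfolding X_def p_def g_def by (intro nat_fps_intros nat_fps_geo) auto
  ultimately show ?thesis
    by (simp add: g_def)
qed

text \<open>The numerator over \<open>((1 - q\<^sup>3) (1 - q\<^sup>4))\<^sup>5\<close> has two negative coefficients, but dividing it by
  \<open>1 - q\<close> replaces its coefficients by their partial sums, which are positive and collected in \<open>S\<close>.\<close>

lemma nat_fps_geo_base:
  "nat_fps (fps_geo 1 * fps_geo 2 *
     ((fps_geo 1 * fps_geo 4) ^ 5 - 3 * fps_X * (fps_geo 2 * fps_geo 3) ^ 5))"
proof -
  define X :: "complex fps" where "X = fps_X"
  have g: "(1 - X ^ i) * fps_geo i = 1" if "i > 0" for i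
    using fps_geo_mult[of i] that by (simp add: X_def)
  have g1: "fps_geo 1 = (1 + X + X^2) * fps_geo 3"
    using g[of 1] g[of 3] by simp algebra
  have g2: "fps_geo 2 = (1 + X^2) * fps_geo 4"
    using g[of 2] g[of 4] by simp algebra
  define S where "S = 1 + 3*X + 18*X^2 + 33*X^3 + 78*X^4 + 99*X^5 + 144*X^6 + 144*X^7 +
     159*X^8 + 149*X^9 + 150*X^10"
  have "(fps_geo 1 * fps_geo 4) ^ 5 - 3 * X * (fps_geo 2 * fps_geo 3) ^ 5 =
    (fps_geo 3 * fps_geo 4) ^ 5 * ((1 + X + X^2)^5 - 3 * X * (1 + X^2)^5)"
    unfolding g1 g2 by (simp only: power_mult_distrib right_diff_distrib mult_ac)
  also have "(1 + X + X^2)^5 - 3 * X * (1 + X^2)^5 = (1 - X) * S + 147 * X^11"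
    unfolding S_def by algebra
  finally have eq: "(fps_geo 1 * fps_geo 4) ^ 5 - 3 * X * (fps_geo 2 * fps_geo 3) ^ 5 =
    (fps_geo 3 * fps_geo 4) ^ 5 * ((1 - X) * S + 147 * X^11)" .
  have "fps_geo 1 * fps_geo 2 * ((fps_geo 1 * fps_geo 4) ^ 5 - 3 * X * (fps_geo 2 * fps_geo 3) ^ 5) =
    fps_geo 2 * (fps_geo 3 * fps_geo 4) ^ 5 * (((1 - X^1) * fps_geo 1) * S + 147 * X^11 * fps_geo 1)"
    unfolding eq by (simp add: algebra_simps)
  then have "fps_geo 1 * fps_geo 2 * ((fps_geo 1 * fps_geo 4) ^ 5 - 3 * X * (fps_geo 2 * fps_geo 3) ^ 5) =
    fps_geo 2 * (fps_geo 3 * fps_geo 4) ^ 5 * (S + 147 * X^11 * fps_geo 1)"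
    by (simp only: g mult_1 zero_less_one)
  moreover have "nat_fps (fps_geo 2 * (fps_geo 3 * fps_geo 4) ^ 5 * (S + 147 * X^11 * fps_geo 1))"
    unfolding S_def X_def by (intro nat_fps_intros nat_fps_geo) auto
  ultimately show ?thesis
    by (simp only: X_def)
qed

text \<open>Induction on the number of blocks; the prefactor \<open>1 / ((1 - q) (1 - q^2))\<close>
  is what \<open>nat_fps_geo_diff\<close> needs when a block is appended.\<close>

lemma nat_fps_fifth_powers:
  "nat_fps (fps_geo 1 * fps_geo 2 * (num_fps (Suc N) ^ 5 - 3 * fps_X * den_fps (Suc N) ^ 5))"
proof (induction N)
  case 0
  then show ?case
    using nat_fps_geo_base by (simp add: num_fps_def den_fps_def)
next
  case (Suc N)
  define C a b where "C = fps_geo 1 * fps_geo 2" and "a = num_fps (Suc N)" and "b = den_fps (Suc N)"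
  define x y where "x = fps_geo (1 + 5 * Suc N) * fps_geo (4 + 5 * Suc N)"
    and "y = fps_geo (2 + 5 * Suc N) * fps_geo (3 + 5 * Suc N)"
  have xy: "nat_fps x" "nat_fps y"
    unfolding x_def y_def by (intro nat_fps_intros nat_fps_geo; simp)+
  \<comment> \<open>With \<open>x\<close> and \<open>y\<close> the new blocks, the remainder is a
    multiple of \<open>x^5 - y^5\<close>, that is, of \<open>x - y\<close> times a nonnegative
    series.\<close>
  have "C * ((a * x) ^ 5 - 3 * fps_X * (b * y) ^ 5) =
    x^5 * (C * (a^5 - 3 * fps_X * b^5)) +
    3 * fps_X * b^5 * (C * (x - y)) * (x^4 + x^3 * y + x^2 * y^2 + x * y^3 + y^4)"
    by algebra
  moreover have "nat_fps (x^5 * K + 3 * fps_X * b^5 * L * (x^4 + x^3 * y + x^2 * y^2 + x * y^3 + y^4))"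
    if "nat_fps K" "nat_fps L" for K L
    unfolding b_def by (intro nat_fps_intros xy that nat_fps_den_fps)
  note this[of "C * (a^5 - 3 * fps_X * b^5)" "C * (x - y)"]
  ultimately show ?case
    unfolding num_fps_Suc[of "Suc N"] den_fps_Suc[of "Suc N"]
    using Suc nat_fps_geo_diff[of "Suc N"] by (simp only: C_def a_def b_def x_def y_def)
qed

text \<open>The outer powers supply \<open>1 / (1 - q)\<close> twice and
  \<open>1 / (1 - q^2)\<close> once: one copy of the former cancels \<open>1 - q\<close>, the rest
  is the prefactor of \<open>nat_fps_fifth_powers\<close>.\<close>

lemma nat_fps_difference:
  "nat_fps ((1 - fps_X) * (num_fps (Suc N) ^ (j + 2) * den_fps (Suc N) ^ (k + 1) *
     (num_fps (Suc N) ^ 5 - 3 * fps_X * den_fps (Suc N) ^ 5)))"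
proof -
  obtain a where a: "nat_fps a" "num_fps (Suc N) = fps_geo 1 * a"
    using num_fps_factor by blast
  obtain b where b: "nat_fps b" "den_fps (Suc N) = fps_geo 2 * b"
    using den_fps_factor by blast
  define H where "H = num_fps (Suc N) ^ 5 - 3 * fps_X * den_fps (Suc N) ^ 5"
  have "(1 - fps_X) * (num_fps (Suc N) ^ (j + 2) * den_fps (Suc N) ^ (k + 1) * H) =
    ((1 - fps_X) * fps_geo 1) * (fps_geo 1 * fps_geo 2 * H) * (fps_geo 1 ^ j * fps_geo 2 ^ k * a ^ (j + 2) * b ^ (k + 1))"
    unfolding a b by (simp add: power_mult_distrib power_add power2_eq_square mult_ac)
  also have "(1 - fps_X) * fps_geo 1 = 1"
    using fps_geo_mult[of 1] by simp
  also have "nat_fps (1 * (fps_geo 1 * fps_geo 2 * H) * (fps_geo 1 ^ j * fps_geo 2 ^ k * a ^ (j + 2) * b ^ (k + 1)))"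
  proof -
    have "nat_fps (1 * (fps_geo 1 * fps_geo 2 * H))"
      using nat_fps_fifth_powers[of N] by (simp add: H_def)
    moreover have "nat_fps (fps_geo 1 ^ j * fps_geo 2 ^ k * a ^ (j + 2) * b ^ (k + 1))"
      by (intro nat_fps_intros nat_fps_geo a b) auto
    ultimately show ?thesis
      by (rule nat_fps_mult)
  qed
  finally show ?thesis
    unfolding H_def .
qed

section \<open>The limit series and strict positivity of their combinations\<close>

definition inv_num_fps :: "complex fps" where
  "inv_num_fps = qpoch_inv_fps 1 * qpoch_inv_fps 4"

definition inv_den_fps :: "complex fps" where
  "inv_den_fps = qpoch_inv_fps 2 * qpoch_inv_fps 3"

lemma fps_tendsto_num: "fps_tendsto num_fps inv_num_fps"
  and fps_tendsto_den: "fps_tendsto den_fps inv_den_fps"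
  unfolding num_fps_def[abs_def] den_fps_def[abs_def] inv_num_fps_def inv_den_fps_def
  by (intro fps_tendsto_mult fps_tendsto_qpoch_inv; simp)+

lemma nat_fps_inv_num: "nat_fps inv_num_fps"
  and nat_fps_inv_den: "nat_fps inv_den_fps"
  using fps_tendsto_nat_fps[OF fps_tendsto_num nat_fps_num_fps]
    fps_tendsto_nat_fps[OF fps_tendsto_den nat_fps_den_fps] by auto

lemma nat_fps_inv_num': "nat_fps ((1 - fps_X) * inv_num_fps)"
proof (rule fps_tendsto_nat_fps)
  show "fps_tendsto (\<lambda>N. (1 - fps_X) * num_fps N) ((1 - fps_X) * inv_num_fps)"
    by (intro fps_tendsto_intros fps_tendsto_num)
  fix N
  obtain F where F: "nat_fps F" "num_fps (Suc N) = fps_geo 1 * F"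
    using num_fps_factor by blast
  have "(1 - fps_X) * num_fps (Suc N) = F"
    using fps_geo_mult[of 1] unfolding F(2) by (simp flip: mult.assoc)
  then show "nat_fps ((1 - fps_X) * num_fps (Suc N))"
    using F(1) by simp
qed

definition pos_fps :: "complex fps \<Rightarrow> bool" where
  "pos_fps F \<longleftrightarrow> (\<forall>n. \<exists>m. fps_nth F n = of_nat (Suc m))"

text \<open>The coefficients of \<open>(1 - fps_X) * F\<close> are the increments of those of
  \<open>F\<close>, which therefore never fall below the initial value 1.\<close>

lemma pos_fpsI:
  assumes "nat_fps ((1 - fps_X) * F)" "fps_nth F 0 = 1"
  shows "pos_fps F"
  unfolding pos_fps_def
proof
  fix n
  show "\<exists>m. fps_nth F n = of_nat (Suc m)"
  proof (induction n)
    case 0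
    then show ?case
      using assms(2) by (intro exI[of _ 0]) simp
  next
    case (Suc n)
    then obtain m where m: "fps_nth F n = of_nat (Suc m)" by blast
    have "fps_nth ((1 - fps_X) * F) (Suc n) = fps_nth F (Suc n) - fps_nth F n"
      by (simp add: left_diff_distrib)
    then obtain k where "fps_nth F (Suc n) - fps_nth F n = of_nat k"
      using assms(1) unfolding nat_fps_def by (metis Nats_cases)
    then have "fps_nth F (Suc n) = of_nat (Suc (m + k))"
      using m by (simp add: algebra_simps)
    then show ?case by blast
  qed
qed

lemma qpoch_inf_0: "qpoch_inf 0 q = 1"
  by (simp add: qpoch_inf_def)

lemma
  shows fps_conv_radius_inv_num: "fps_conv_radius inv_num_fps \<ge> 1"
    and fps_conv_radius_inv_den: "fps_conv_radius inv_den_fps \<ge> 1"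
  unfolding inv_num_fps_def inv_den_fps_def
  by (rule order_trans[OF _ fps_conv_radius_mult]; simp add: fps_conv_radius_qpoch_inv)+

lemma
  assumes "norm z < 1"
  shows eval_fps_inv_num: "eval_fps inv_num_fps z = inverse (RR_num z)"
    and eval_fps_inv_den: "eval_fps inv_den_fps z = inverse (RR_den z)"
proof -
  have "ereal (norm z) < fps_conv_radius (qpoch_inv_fps i)" if "i > 0" for i
  proof -
    have "ereal (norm z) < 1"
      using assms by simp
    then show ?thesis
      using fps_conv_radius_qpoch_inv[OF that] by (rule less_le_trans)
  qed
  then show "eval_fps inv_num_fps z = inverse (RR_num z)" "eval_fps inv_den_fps z = inverse (RR_den z)"
    unfolding inv_num_fps_def inv_den_fps_def RR_num_def RR_den_def
    using assms by (simp_all add: eval_fps_mult eval_fps_qpoch_inv)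
qed

lemma inv_fps_nth_0: "fps_nth inv_num_fps 0 = 1" "fps_nth inv_den_fps 0 = 1"
  using eval_fps_inv_num[of 0] eval_fps_inv_den[of 0]
  by (simp_all add: eval_fps_at_0 RR_num_def RR_den_def qpoch_inf_0)

lemma pos_fps_inv_power: "pos_fps (inv_num_fps ^ Suc j * inv_den_fps ^ k)"
proof (rule pos_fpsI)
  have "(1 - fps_X) * (inv_num_fps ^ Suc j * inv_den_fps ^ k) =
      ((1 - fps_X) * inv_num_fps) * inv_num_fps ^ j * inv_den_fps ^ k"
    by (simp only: power_Suc mult_ac)
  then show "nat_fps ((1 - fps_X) * (inv_num_fps ^ Suc j * inv_den_fps ^ k))"
    by (simp only:) (intro nat_fps_mult nat_fps_power nat_fps_inv_num' nat_fps_inv_num nat_fps_inv_den)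
qed (simp add: inv_fps_nth_0 fps_nth_power_0)

text \<open>The limit of \<open>nat_fps_difference\<close>. The pairs \<open>j = 2, k = 2\<close>
  and \<open>j = 1, k = 3\<close> give the components for the residues 2 and 3.\<close>

lemma pos_fps_difference:
  "pos_fps (inv_num_fps ^ (j + 7) * inv_den_fps ^ (k + 1) -
     3 * fps_X * (inv_num_fps ^ (j + 2) * inv_den_fps ^ (k + 6)))"
proof (rule pos_fpsI)
  let ?F = "\<lambda>a b. (1 - fps_X) * (a ^ (j + 2) * b ^ (k + 1) * (a ^ 5 - 3 * fps_X * b ^ 5)) :: complex fps"
  have "nat_fps (?F inv_num_fps inv_den_fps)"
  proof (rule fps_tendsto_nat_fps)
    show "fps_tendsto (\<lambda>N. ?F (num_fps N) (den_fps N)) (?F inv_num_fps inv_den_fps)"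
      by (intro fps_tendsto_intros fps_tendsto_num fps_tendsto_den)
  qed (rule nat_fps_difference)
  also have "?F inv_num_fps inv_den_fps = (1 - fps_X) * (inv_num_fps ^ (j + 7) * inv_den_fps ^ (k + 1) -
     3 * fps_X * (inv_num_fps ^ (j + 2) * inv_den_fps ^ (k + 6)))"
    by (simp add: power_add algebra_simps eval_nat_numeral)
  finally show "nat_fps \<dots>" .
qed (simp add: inv_fps_nth_0 fps_nth_power_0)

section \<open>The coefficients \<open>D(n)\<close>\<close>

text \<open>Each residue class is padded with zeros to a series over all indices, and the
  \<open>k\<close> padded series are added.\<close>

lemma sums_residue_classes:
  fixes q :: "'a :: {real_normed_algebra_1, comm_ring_1}" and c :: "nat \<Rightarrow> nat \<Rightarrow> 'a"
  assumes "k > 0" "\<And>r. r < k \<Longrightarrow> (\<lambda>n. c r n * (q ^ k) ^ n) sums s r"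
  shows "(\<lambda>n. c (n mod k) (n div k) * q ^ n) sums (\<Sum>r<k. q ^ r * s r)"
proof -
  let ?f = "\<lambda>r n. if n mod k = r then c (n mod k) (n div k) * q ^ n else 0"
  have "?f r sums (q ^ r * s r)" if r: "r < k" for r
  proof -
    have "(\<lambda>n. q ^ r * (c r n * (q ^ k) ^ n)) sums (q ^ r * s r)"
      using assms(2)[OF r] by (rule sums_mult)
    also have "(\<lambda>n. q ^ r * (c r n * (q ^ k) ^ n)) = (\<lambda>n. ?f r (k * n + r))"
      using r by (simp add: power_add power_mult[symmetric] mult_ac)
    also have "\<dots> sums (q ^ r * s r) \<longleftrightarrow> ?thesis"
    proof (rule sums_mono_reindex)
      show "strict_mono (\<lambda>n. k * n + r)"
        using assms(1) by (auto simp: strict_mono_def)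
      show "?f r n = 0" if "n \<notin> range (\<lambda>n. k * n + r)" for n
        using that by (metis mult_div_mod_eq rangeI)
    qed
    finally show ?thesis .
  qed
  then have "(\<lambda>n. \<Sum>r<k. ?f r n) sums (\<Sum>r<k. q ^ r * s r)"
    by (intro sums_sum) auto
  moreover have "(\<Sum>r<k. ?f r n) = c (n mod k) (n div k) * q ^ n" for n
    using assms(1) by (subst sum.delta') auto
  ultimately show ?thesis
    by simp
qed

text \<open>Uniqueness for the definite description that defines \<open>D\<close>.\<close>

lemma power_series_int_unique:
  fixes c d :: "nat \<Rightarrow> int" and f :: "complex \<Rightarrow> complex"
  assumes "\<And>z. norm z < 1 \<Longrightarrow> (\<lambda>n. of_int (c n) * z ^ n) sums f z"
    and "\<And>z. norm z < 1 \<Longrightarrow> (\<lambda>n. of_int (d n) * z ^ n) sums f z"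
  shows "c = d"
proof -
  define F G :: "complex fps" where "F = Abs_fps (\<lambda>n. of_int (c n))" and "G = Abs_fps (\<lambda>n. of_int (d n))"
  have "f has_fps_expansion F" "f has_fps_expansion G"
    using assms unfolding F_def G_def
    by (auto intro!: has_fps_expansionI eventually_mono[OF eventually_nhds_in_open[of "ball 0 1"]])
  then have "F = G"
    by (rule fps_expansion_unique_complex)
  then show ?thesis
    by (auto simp: F_def G_def fps_eq_iff)
qed

section \<open>Integrality and expansions valid on the whole unit disc\<close>

definition int_fps :: "complex fps \<Rightarrow> bool" where
  "int_fps F \<longleftrightarrow> (\<forall>n. fps_nth F n \<in> \<int>)"

lemma nat_fps_imp_int_fps: "nat_fps F \<Longrightarrow> int_fps F"
  using Nats_subset_Ints by (auto simp: nat_fps_def int_fps_def)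

lemma int_fps_diff: "int_fps F \<Longrightarrow> int_fps G \<Longrightarrow> int_fps (F - G)"
  by (simp add: int_fps_def)

lemma int_fps_uminus: "int_fps F \<Longrightarrow> int_fps (- F)"
  by (simp add: int_fps_def)

lemma int_fps_mult: "int_fps F \<Longrightarrow> int_fps G \<Longrightarrow> int_fps (F * G)"
  by (auto simp: int_fps_def fps_mult_nth)

lemma int_fps_add: "int_fps F \<Longrightarrow> int_fps G \<Longrightarrow> int_fps (F + G)"
  by (simp add: int_fps_def)

lemma int_fps_power: "int_fps F \<Longrightarrow> int_fps (F ^ n)"
  by (induction n) (auto intro: int_fps_mult nat_fps_imp_int_fps nat_fps_1)

lemmas int_fps_intros = nat_fps_1[THEN nat_fps_imp_int_fps] nat_fps_numeral[THEN nat_fps_imp_int_fps]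
  nat_fps_X[THEN nat_fps_imp_int_fps] nat_fps_inv_num[THEN nat_fps_imp_int_fps]
  nat_fps_inv_den[THEN nat_fps_imp_int_fps]
  int_fps_diff int_fps_uminus int_fps_add int_fps_mult int_fps_power

definition disc_expansion :: "(complex \<Rightarrow> complex) \<Rightarrow> complex fps \<Rightarrow> bool" where
  "disc_expansion f F \<longleftrightarrow> fps_conv_radius F \<ge> 1 \<and> (\<forall>z. norm z < 1 \<longrightarrow> eval_fps F z = f z)"

lemma disc_expansion_radius:
  fixes z :: complex
  assumes "disc_expansion f F" "norm z < 1"
  shows "ereal (norm z) < fps_conv_radius F"
proof -
  have "ereal (norm z) < 1"
    using assms by simp
  then show ?thesis
    using assms(1) unfolding disc_expansion_def by (blast intro: less_le_trans)
qed

lemma disc_expansion_sums: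
  assumes "disc_expansion f F" "norm z < 1"
  shows "(\<lambda>n. fps_nth F n * z ^ n) sums f z"
  using sums_eval_fps[OF disc_expansion_radius[OF assms]] assms by (simp add: disc_expansion_def)

lemma disc_expansion_1: "disc_expansion (\<lambda>z. 1) 1"
  and disc_expansion_numeral: "disc_expansion (\<lambda>z. numeral k) (numeral k)"
  and disc_expansion_X: "disc_expansion (\<lambda>z. z) fps_X"
  by (simp_all add: disc_expansion_def)

lemma disc_expansion_uminus:
  assumes "disc_expansion f F"
  shows "disc_expansion (\<lambda>z. - f z) (- F)"
  using assms disc_expansion_radius[OF assms] by (auto simp: disc_expansion_def eval_fps_minus)

lemma disc_expansion_add:
  assumes "disc_expansion f F" "disc_expansion g G"
  shows "disc_expansion (\<lambda>z. f z + g z) (F + G)"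
  using assms disc_expansion_radius[OF assms(1)] disc_expansion_radius[OF assms(2)]
    order_trans[OF _ fps_conv_radius_add[of F G], of 1]
  by (auto simp: disc_expansion_def eval_fps_add)

lemma disc_expansion_diff:
  assumes "disc_expansion f F" "disc_expansion g G"
  shows "disc_expansion (\<lambda>z. f z - g z) (F - G)"
  using assms disc_expansion_radius[OF assms(1)] disc_expansion_radius[OF assms(2)]
    order_trans[OF _ fps_conv_radius_diff[of F G], of 1]
  by (auto simp: disc_expansion_def eval_fps_diff)

lemma disc_expansion_mult:
  assumes "disc_expansion f F" "disc_expansion g G"
  shows "disc_expansion (\<lambda>z. f z * g z) (F * G)"
  using assms disc_expansion_radius[OF assms(1)] disc_expansion_radius[OF assms(2)]
    order_trans[OF _ fps_conv_radius_mult[of F G], of 1]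
  by (auto simp: disc_expansion_def eval_fps_mult)

lemma disc_expansion_power:
  assumes "disc_expansion f F"
  shows "disc_expansion (\<lambda>z. f z ^ n) (F ^ n)"
  by (induction n) (auto intro: disc_expansion_1 disc_expansion_mult assms)

lemma disc_expansion_inv_num: "disc_expansion (\<lambda>z. inverse (RR_num z)) inv_num_fps"
  and disc_expansion_inv_den: "disc_expansion (\<lambda>z. inverse (RR_den z)) inv_den_fps"
  by (simp_all add: disc_expansion_def fps_conv_radius_inv_num fps_conv_radius_inv_den
      eval_fps_inv_num eval_fps_inv_den)

lemmas disc_expansion_intros =
  disc_expansion_1 disc_expansion_numeral disc_expansion_X disc_expansion_uminus disc_expansion_add
  disc_expansion_diff disc_expansion_mult disc_expansion_power disc_expansion_inv_num
  disc_expansion_inv_den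

text \<open>The variable stands for \<open>q^5\<close>. Residue 1 has a component too, since the
  five together must add up to the quotient.\<close>

definition dissection_fps :: "nat \<Rightarrow> complex fps" where
  "dissection_fps r = (let a = inv_num_fps; b = inv_den_fps in
     [1 - 25 * fps_X * (a^6 * b^6),
      5 * (a^10 * b^2 - 8 * fps_X * (a^5 * b^7)),
      10 * (a^9 * b^3 - 3 * fps_X * (a^4 * b^8)),
      5 * (a^8 * b^4 - 3 * fps_X * (a^3 * b^9)),
      - (5 * (3 * (a^7 * b^5) + fps_X * (a^2 * b^10)))] ! r)"

definition dissection_fun :: "nat \<Rightarrow> complex \<Rightarrow> complex" where
  "dissection_fun r z = (let a = inverse (RR_num z); b = inverse (RR_den z) in
     [1 - 25 * z * (a^6 * b^6),
      5 * (a^10 * b^2 - 8 * z * (a^5 * b^7)),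
      10 * (a^9 * b^3 - 3 * z * (a^4 * b^8)),
      5 * (a^8 * b^4 - 3 * z * (a^3 * b^9)),
      - (5 * (3 * (a^7 * b^5) + z * (a^2 * b^10)))] ! r)"

lemma less_5_cases: "r < (5::nat) \<Longrightarrow> r = 0 \<or> r = 1 \<or> r = 2 \<or> r = 3 \<or> r = 4"
  by auto

lemma dissection_fps_simps:
  "dissection_fps 0 = 1 - 25 * fps_X * (inv_num_fps^6 * inv_den_fps^6)"
  "dissection_fps 1 = 5 * (inv_num_fps^10 * inv_den_fps^2 - 8 * fps_X * (inv_num_fps^5 * inv_den_fps^7))"
  "dissection_fps 2 = 10 * (inv_num_fps^9 * inv_den_fps^3 - 3 * fps_X * (inv_num_fps^4 * inv_den_fps^8))"
  "dissection_fps 3 = 5 * (inv_num_fps^8 * inv_den_fps^4 - 3 * fps_X * (inv_num_fps^3 * inv_den_fps^9))"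
  "dissection_fps 4 = - (5 * (3 * (inv_num_fps^7 * inv_den_fps^5) + fps_X * (inv_num_fps^2 * inv_den_fps^10)))"
  by (simp_all add: dissection_fps_def Let_def)

lemma dissection_fun_simps:
  fixes z :: complex
  defines "a \<equiv> inverse (RR_num z)" and "b \<equiv> inverse (RR_den z)"
  shows "dissection_fun 0 z = 1 - 25 * z * (a^6 * b^6)"
    and "dissection_fun 1 z = 5 * (a^10 * b^2 - 8 * z * (a^5 * b^7))"
    and "dissection_fun 2 z = 10 * (a^9 * b^3 - 3 * z * (a^4 * b^8))"
    and "dissection_fun 3 z = 5 * (a^8 * b^4 - 3 * z * (a^3 * b^9))"
    and "dissection_fun 4 z = - (5 * (3 * (a^7 * b^5) + z * (a^2 * b^10)))"
  unfolding a_def b_def by (simp_all add: dissection_fun_def Let_def)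

lemma disc_expansion_dissection:
  assumes "r < 5"
  shows "disc_expansion (dissection_fun r) (dissection_fps r)"
proof -
  have "disc_expansion (\<lambda>z. dissection_fun r z) (dissection_fps r)"
    using less_5_cases[OF assms]
    by (elim disjE; simp only: dissection_fun_simps dissection_fps_simps; intro disc_expansion_intros)
  then show ?thesis .
qed

lemma int_fps_dissection:
  assumes "r < 5"
  shows "int_fps (dissection_fps r)"
  using less_5_cases[OF assms]
  by (elim disjE; simp only: dissection_fps_simps; intro int_fps_intros)

lemma lessThan_5: "{..<5} = {0, 1, 2, 3, 4::nat}"
  by auto

text \<open>The point \<open>q = 0\<close> is treated apart because
  \<open>RR_quotient_dissection\<close> divides by \<open>u\<close>; both sides are 1 there.\<close>

theorem RR_quotient_eq_dissection:
  assumes "norm q < 1"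
  shows "RR (q ^ 5) / RR q ^ 5 = (\<Sum>r<5. q ^ r * dissection_fun r (q ^ 5))"
proof (cases "q = 0")
  case True
  then show ?thesis
    by (simp add: RR_def qpoch_inf_0 dissection_fun_simps lessThan_5 RR_num_def RR_den_def)
next
  case False
  then show ?thesis
    unfolding RR_quotient_dissection[OF False assms]
    by (simp add: lessThan_5 dissection_fun_simps[unfolded One_nat_def] algebra_simps)
qed

text \<open>Interleaving the integer coefficients of the five components expands the quotient, and
  uniqueness identifies the result with \<open>D\<close>.\<close>

theorem D_dissection:
  assumes "r < 5"
  shows "of_int (D (5 * n + r)) = fps_nth (dissection_fps r) n"
proof -
  \<comment> \<open>Floor and real part merely change the type, as the coefficients are integers for
    \<open>r < 5\<close>.\<close>
  define c where "c = (\<lambda>r n. \<lfloor>Re (fps_nth (dissection_fps r) n)\<rfloor>)"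
  have c: "of_int (c r n) = fps_nth (dissection_fps r) n" if "r < 5" for r n
    using int_fps_dissection[OF that] unfolding int_fps_def c_def
    by (metis Ints_cases Re_complex_of_real floor_of_int of_real_of_int_eq)
  define d where "d = (\<lambda>n. c (n mod 5) (n div 5))"
  have d: "(\<lambda>n. of_int (d n) * q ^ n) sums (RR (q ^ 5) / RR q ^ 5)" if "norm q < 1" for q
    unfolding RR_quotient_eq_dissection[OF that] d_def
  proof (rule sums_residue_classes[where c = "\<lambda>r n. of_int (c r n)"])
    fix r :: nat assume "r < 5"
    then show "(\<lambda>n. of_int (c r n) * (q ^ 5) ^ n) sums dissection_fun r (q ^ 5)"
      unfolding c[OF \<open>r < 5\<close>]
      by (intro disc_expansion_sums disc_expansion_dissection norm_power_less_1 that) auto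
  qed auto
  have Dd: "D = d"
    unfolding D_def
  proof (rule the_equality)
    show "\<forall>q. norm q < 1 \<longrightarrow> (\<lambda>n. of_int (d n) * q ^ n) sums (RR (q ^ 5) / RR q ^ 5)"
      using d by blast
    show "d' = d" if "\<forall>q. norm q < 1 \<longrightarrow> (\<lambda>n. of_int (d' n) * q ^ n) sums (RR (q ^ 5) / RR q ^ 5)" for d'
      using that d by (intro power_series_int_unique) auto
  qed
  have "d (5 * n + r) = c r n"
    using assms by (simp add: d_def)
  then show ?thesis
    unfolding Dd using c[OF assms] by simp
qed

lemma pos_fps_dissection:
  shows "pos_fps (inv_num_fps^6 * inv_den_fps^6)"
    and "pos_fps (inv_num_fps^9 * inv_den_fps^3 - 3 * fps_X * (inv_num_fps^4 * inv_den_fps^8))"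
    and "pos_fps (inv_num_fps^8 * inv_den_fps^4 - 3 * fps_X * (inv_num_fps^3 * inv_den_fps^9))"
    and "pos_fps (inv_num_fps^7 * inv_den_fps^5)"
  using pos_fps_inv_power[of 5 6] pos_fps_difference[of 2 2] pos_fps_difference[of 1 3]
    pos_fps_inv_power[of 6 5] by (simp_all add: power3_eq_cube mult.assoc)

theorem theorem1p5:
  shows "D 0 = 1 \<and>
    (\<forall>n::nat. (n \<noteq> 0 \<longrightarrow> D (5 * n) < 0) \<and>
       D (5 * n + 2) > 0 \<and> D (5 * n + 3) > 0 \<and> D (5 * n + 4) < 0)"
proof (intro conjI allI impI)
  have D0: "of_int (D (5 * n)) = fps_nth (1 - 25 * fps_X * (inv_num_fps^6 * inv_den_fps^6)) n" for n
    using D_dissection[of 0 n] by (simp add: dissection_fps_simps)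
  have "of_int (D 0) = (1 :: complex)"
    using D0[of 0] by simp
  then show "D 0 = 1"
    by simp
  fix n :: nat
  show "D (5 * n) < 0" if n0: "n \<noteq> 0"
  proof -
    \<comment> \<open>The factor \<open>fps_X\<close> shifts indices, so the coefficient at
      \<open>n\<close> comes from \<open>k = n - 1\<close>; at \<open>n = 0\<close> only the
      constant 1 is left.\<close>
    obtain k where k: "n = Suc k"
      using n0 not0_implies_Suc by blast
    obtain m where m: "fps_nth (inv_num_fps^6 * inv_den_fps^6) k = of_nat (Suc m)"
      using pos_fps_dissection(1) unfolding pos_fps_def by blast
    have "of_int (D (5 * n)) = - 25 * fps_nth (inv_num_fps^6 * inv_den_fps^6) k"
      unfolding D0 k by (simp add: mult.assoc)
    also have "\<dots> = of_int (- 25 * int (Suc m))"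
      unfolding m by simp
    finally show ?thesis
      unfolding of_int_eq_iff by simp
  qed
  show "D (5 * n + 2) > 0"
  proof -
    obtain m where m: "fps_nth (inv_num_fps^9 * inv_den_fps^3 - 3 * fps_X * (inv_num_fps^4 * inv_den_fps^8)) n = of_nat (Suc m)"
      using pos_fps_dissection(2) unfolding pos_fps_def by blast
    have "of_int (D (5 * n + 2)) = 10 * (of_nat (Suc m) :: complex)"
      unfolding m[symmetric] fps_mult_numeral_left[symmetric] dissection_fps_simps[symmetric]
      by (rule D_dissection) simp
    also have "\<dots> = of_int (10 * int (Suc m))"
      by simp
    finally show ?thesis
      unfolding of_int_eq_iff by simp
  qed
  show "D (5 * n + 3) > 0"
  proof -
    obtain m where m: "fps_nth (inv_num_fps^8 * inv_den_fps^4 - 3 * fps_X * (inv_num_fps^3 * inv_den_fps^9)) n = of_nat (Suc m)"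
      using pos_fps_dissection(3) unfolding pos_fps_def by blast
    have "of_int (D (5 * n + 3)) = 5 * (of_nat (Suc m) :: complex)"
      unfolding m[symmetric] fps_mult_numeral_left[symmetric] dissection_fps_simps[symmetric]
      by (rule D_dissection) simp
    also have "\<dots> = of_int (5 * int (Suc m))"
      by simp
    finally show ?thesis
      unfolding of_int_eq_iff by simp
  qed
  show "D (5 * n + 4) < 0"
  proof -
    obtain m where m: "fps_nth (inv_num_fps^7 * inv_den_fps^5) n = of_nat (Suc m)"
      using pos_fps_dissection(4) unfolding pos_fps_def by blast
    \<comment> \<open>This term may vanish, for instance at \<open>n = 0\<close>; strictness comes
      from \<open>inv_num_fps^7 * inv_den_fps^5\<close>.\<close>
    have "nat_fps (fps_X * (inv_num_fps^2 * inv_den_fps^10))"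
      by (intro nat_fps_intros nat_fps_inv_num nat_fps_inv_den)
    then obtain k where k: "fps_nth (fps_X * (inv_num_fps^2 * inv_den_fps^10)) n = of_nat k"
      unfolding nat_fps_def by (metis Nats_cases)
    have "of_int (D (5 * n + 4)) = - (5 * (3 * of_nat (Suc m) + of_nat k :: complex))"
      unfolding m[symmetric] k[symmetric] using D_dissection[of 4 n]
      by (simp add: dissection_fps_simps del: fps_X_mult_nth)
    also have "\<dots> = of_int (- (5 * (3 * int (Suc m) + int k)))"
      by simp
    finally show ?thesis
      unfolding of_int_eq_iff by simp
  qed
qed

end
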